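(* Let $d=d_N$ be any sequence of positive integers (degrees) and, for each $N$, let $U(1),\dots,U(d)$ be any $d$ unitary matrices of dimension $N$ (depending on $N$). Let $\mathcal{E}:\mathrm{M}_N(\mathbb{C})\to \mathrm{M}_N(\mathbb{C})$ be the operator $\mathcal{E}(M)=\frac1d\sum_{s=1}^{d}U(s)^*MU(s)$. Set $\sigma_d=\frac{2\sqrt{d-1}}{d}$ and $p=p_N=\left\lfloor \frac{\ln(N)}{2\ln(1/\sigma_d)}\right\rfloor$. There exists $c>0$ such that for all $N\ge 2$ and for all $2\le d=d_N\le N^{1/4}$, $$s_2(\mathcal{E})\ \ge\ \sigma_d\left(\frac{c}{\ln(N)^{3/2}}\right)^{1/2p},$$ where the exponent $1/2p$ means $1/(2p)$.
   Context: $\mathrm{M}_N(\mathbb{C})$ is the space of $N\times N$ complex matrices, regarded as an $N^2$-dimensional Hilbert space with the scalar product $(A,B)=\mathrm{Tr}(AB^* )$. For a linear operator $\mathcal{T}$ on $\mathrm{M}_N(\mathbb{C})$, $s_1(\mathcal{T})\ge s_2(\mathcal{T})\ge\cdots\ge s_{N^2}(\mathcal{T})$ are its singular values with respect to this scalar product, counted with multiplicity (square roots of the eigenvalues of $\mathcal{T}^*\mathcal{T}$). *)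

theory Defs
  imports
    Complex_Main
    "HOL-Library.Multiset"
    "HOL-Computational_Algebra.Polynomial"
    "Jordan_Normal_Form.Char_Poly"
    "Jordan_Normal_Form.Schur_Decomposition"
begin

(* Since the dimension N is quantified inside the statement, M_N(C) is carrier_mat N N in the type
   complex mat. Operators on M_N(C) are functions on complex mat; only their values on
   carrier_mat N N matter. *)

definition unitary_mat :: "nat \<Rightarrow> complex mat \<Rightarrow> bool" where
  "unitary_mat N U \<longleftrightarrow> U \<in> carrier_mat N N \<and>
     U * mat_adjoint U = 1\<^sub>m N \<and> mat_adjoint U * U = 1\<^sub>m N"

definition trace_mat :: "complex mat \<Rightarrow> complex" where
  "trace_mat A = (\<Sum>i<dim_row A. A $$ (i, i))"

definition hs_inner :: "complex mat \<Rightarrow> complex mat \<Rightarrow> complex" where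
  "hs_inner A B = trace_mat (A * mat_adjoint B)"

(* For linear T the condition below determines S uniquely on carrier_mat N N. *)
definition hs_adjoint :: "nat \<Rightarrow> (complex mat \<Rightarrow> complex mat) \<Rightarrow> complex mat \<Rightarrow> complex mat" where
  "hs_adjoint N T = (SOME S. \<forall>B \<in> carrier_mat N N. S B \<in> carrier_mat N N \<and>
     (\<forall>A \<in> carrier_mat N N. hs_inner (T A) B = hs_inner A (S B)))"

(* The matrix unit with row b div N and column b mod N: for b < N * N this enumerates
   the standard basis of M_N(C). *)
definition matrix_unit :: "nat \<Rightarrow> nat \<Rightarrow> complex mat" where
  "matrix_unit N b = mat N N (\<lambda>(i, j). if i = b div N \<and> j = b mod N then 1 else 0)"

(* The N^2 x N^2 matrix of T in the basis of matrix units; column b holds the coordinates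
   of T (matrix_unit N b). *)
definition operator_mat :: "nat \<Rightarrow> (complex mat \<Rightarrow> complex mat) \<Rightarrow> complex mat" where
  "operator_mat N T =
     mat (N * N) (N * N) (\<lambda>(a, b). T (matrix_unit N b) $$ (a div N, a mod N))"

(* Eigenvalues with algebraic multiplicity, as roots of the characteristic polynomial. *)
definition operator_eigenvalues :: "nat \<Rightarrow> (complex mat \<Rightarrow> complex mat) \<Rightarrow> complex multiset" where
  "operator_eigenvalues N T = proots (char_poly (operator_mat N T))"

(* Non-increasing list of length N^2. The eigenvalues of the composition of the adjoint of T with T
   are real and nonnegative, so taking Re loses nothing. *)
definition singular_values :: "nat \<Rightarrow> (complex mat \<Rightarrow> complex mat) \<Rightarrow> real list" where
  "singular_values N T = rev (sorted_list_of_multiset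
     (image_mset (\<lambda>z. sqrt (Re z)) (operator_eigenvalues N (hs_adjoint N T \<circ> T))))"

(* Numbered from k = 1, the largest one. *)
definition singular_value :: "nat \<Rightarrow> nat \<Rightarrow> (complex mat \<Rightarrow> complex mat) \<Rightarrow> real" where
  "singular_value N k T = singular_values N T ! (k - 1)"

(* The sum of matrices is written entrywise, as the type complex mat has no zero element
   and hence no sum over sets. *)
definition expander_op :: "nat \<Rightarrow> nat \<Rightarrow> (nat \<Rightarrow> complex mat) \<Rightarrow> complex mat \<Rightarrow> complex mat" where
  "expander_op N d U M =
     mat N N (\<lambda>(i, j). 1 / of_nat d * (\<Sum>s = 1..d. (mat_adjoint (U s) * M * U s) $$ (i, j)))"

definition sigma_deg :: "nat \<Rightarrow> real" where
  "sigma_deg d = 2 * sqrt (real d - 1) / real d"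

(* For d = 2 we have sigma_deg d = 1 and the quotient is formally infinite. Read with p infinite,
   the exponent 1 / (2 * p) is 0; division by zero being 0, the definition gives p = 0, for which
   1 / (2 * p) is 0 as well. *)
definition p_exp :: "nat \<Rightarrow> nat \<Rightarrow> int" where
  "p_exp N d = \<lfloor>ln (real N) / (2 * ln (1 / sigma_deg d))\<rfloor>"

end

theory Submission
  imports Defs "HOL-Analysis.Convex" "HOL-Real_Asymp.Real_Asymp"
begin

text \<open>
  Write \<open>\<phi>(W)\<close> for the \<open>N^2 \<times> N^2\<close> matrix of \<open>M \<mapsto> W M W\<^sup>*\<close>. It is multiplicative, compatible with
  adjoints, and its trace is \<open>\<bar>Tr W\<bar>\<^sup>2 \<ge> 0\<close>. The expander operator has the matrix \<open>A\<close> that averages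
  the unitary matrices \<open>K\<^sub>s = \<phi>(U\<^sub>s\<^sup>*)\<close>, so \<open>A\<close> is a contraction, all singular values lie in \<open>[0, 1]\<close>, and
  bounding the largest one by 1 gives, for every \<open>p\<close>,
  \<open>Tr (A\<^sup>* A)^p \<le> 1 + N^2 s\<^sub>2^(2p)\<close>.

  Expanding the trace yields \<open>d^(-2p)\<close> times the sum of the traces of all words of length \<open>2p\<close> in which
  letters \<open>K\<^sub>s\<^sup>*\<close> and \<open>K\<^sub>t\<close> alternate. All these traces are nonnegative, and equal neighbours cancel, so
  a word that cancels completely contributes \<open>N^2\<close>. Such words are closed walks on the \<open>d\<close>-regular tree,
  and there are at least \<open>(d - 1)^p\<close> times the \<open>p\<close>-th Catalan number of them
  (\<open>trace_gram_power_lower_bound\<close>). As the Catalan number is at least \<open>4^p / (4 p^(3/2))\<close> and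
  \<open>\<sigma>\<^sup>2 = 4 (d - 1) / d\<^sup>2\<close>, the result is \<open>s\<^sub>2^(2p) \<ge> \<sigma>^(2p) / (4 p^(3/2)) - 1 / N^2\<close>
  (\<open>second_singular_value_walk_bound\<close>).

  For \<open>d \<ge> 3\<close> the choice of \<open>p\<close> in the theorem is the largest one with \<open>\<sigma>^(2p) \<ge> 1 / N\<close>; it is of order
  at most \<open>ln N\<close>, uniformly in \<open>d\<close>. For large \<open>N\<close> the error \<open>1 / N^2\<close> is then at most half of the main
  term, and taking \<open>2p\<close>-th roots finishes the proof. For the finitely many remaining \<open>N\<close> the case \<open>p = 1\<close>
  of the trace inequality bounds \<open>s\<^sub>2\<close> away from 0, and it suffices to shrink \<open>c\<close>.

  For \<open>d = 2\<close> we have \<open>\<sigma> = 1\<close>, and the claim is \<open>s\<^sub>2 \<ge> 1\<close>. Here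
  \<open>A\<^sup>* A = (2 + \<phi>(V) + \<phi>(V^(-1))) / 4\<close> with \<open>V = U\<^sub>1 U\<^sub>2\<^sup>*\<close>. Triangularising \<open>V\<close> triangularises this
  matrix, and its \<open>N\<close> diagonal entries that belong to the diagonal matrix units are at least 1, so at
  least two eigenvalues are (\<open>second_singular_value_two\<close>).
\<close>

section \<open>Adjoints and traces of matrices\<close>

lemma index_mult_mat_sum:
  assumes "A \<in> carrier_mat m n" "B \<in> carrier_mat n l" "i < m" "j < l"
  shows "(A * B) $$ (i, j) = (\<Sum>k<n. A $$ (i, k) * B $$ (k, j))"
  using assms by (auto simp: scalar_prod_def lessThan_atLeast0 intro!: sum.cong)

lemma mat_adjoint_carrier: "A \<in> carrier_mat m n \<Longrightarrow> mat_adjoint A \<in> carrier_mat n m"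
  by (auto simp: mat_adjoint_def mat_of_rows_def)

lemma mat_adjoint_index:
  assumes "A \<in> carrier_mat m n" "i < n" "j < m"
  shows "mat_adjoint A $$ (i, j) = cnj (A $$ (j, i))"
  using assms by (auto simp: mat_adjoint_def mat_of_rows_index conjugate_complex_def)

lemma mat_adjoint_adjoint:
  assumes "A \<in> carrier_mat m n"
  shows "mat_adjoint (mat_adjoint A) = (A :: complex mat)"
  using assms mat_adjoint_carrier[OF assms] mat_adjoint_carrier[OF mat_adjoint_carrier[OF assms]]
  by (intro eq_matI) (auto simp: mat_adjoint_index)

lemma trace_mat_mult_sum:
  assumes "A \<in> carrier_mat m n" "B \<in> carrier_mat n m"
  shows "trace_mat (A * B) = (\<Sum>i<m. \<Sum>k<n. A $$ (i, k) * B $$ (k, i))"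
  using assms by (auto simp: trace_mat_def index_mult_mat_sum[OF assms] simp del: index_mult_mat(1))

lemma trace_mat_comm:
  assumes "A \<in> carrier_mat m n" "B \<in> carrier_mat n m"
  shows "trace_mat (A * B) = trace_mat (B * A)"
  unfolding trace_mat_mult_sum[OF assms] trace_mat_mult_sum[OF assms(2,1)]
  by (subst sum.swap) (simp add: mult.commute)

lemma trace_mat_one: "trace_mat (1\<^sub>m n) = of_nat n"
  by (simp add: trace_mat_def)

lemma div_mod_bounds: "a < N * N \<Longrightarrow> a div N < N \<and> a mod N < (N :: nat)"
  by (cases "N = 0") (auto simp: less_mult_imp_div_less)

lemma sum_div_mod:
  fixes f :: "nat \<Rightarrow> nat \<Rightarrow> 'a :: comm_monoid_add"
  shows "(\<Sum>a<N * N. f (a div N) (a mod N)) = (\<Sum>i<N. \<Sum>j<N. f i j)"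
proof -
  have "(\<Sum>i<N. \<Sum>j<N. f i j) = (\<Sum>(i, j)\<in>{..<N} \<times> {..<N}. f i j)"
    by (rule sum.cartesian_product)
  also have "\<dots> = (\<Sum>a<N * N. f (a div N) (a mod N))"
  proof (rule sum.reindex_bij_witness[of _ "\<lambda>a. (a div N, a mod N)" "\<lambda>(i, j). i * N + j"])
    fix x assume "x \<in> {..<N} \<times> {..<N}"
    then obtain i j where x: "x = (i, j)" "i < N" "j < N" by auto
    have "i * N + j < Suc i * N" using x by simp
    also have "\<dots> \<le> N * N" using x by (intro mult_right_mono) auto
    finally show "(case x of (i, j) \<Rightarrow> i * N + j) \<in> {..<N * N}" using x by simp
  qed (use div_mod_bounds in auto)
  finally show ?thesis by simp
qed

section \<open>The matrix of a conjugation\<close>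

text \<open>The matrix of \<open>M \<mapsto> W M W\<^sup>*\<close> in the basis of matrix units, that is, the Kronecker product of \<open>W\<close> with
  its entrywise conjugate. The index pair \<open>(i, j)\<close> is coded as \<open>i * N + j\<close>, as in
  \<^const>\<open>matrix_unit\<close>.\<close>
definition conjugation_mat :: "nat \<Rightarrow> complex mat \<Rightarrow> complex mat" where
  "conjugation_mat N W = mat (N * N) (N * N)
     (\<lambda>(a, b). W $$ (a div N, b div N) * cnj (W $$ (a mod N, b mod N)))"

lemma conjugation_mat_carrier [simp]: "conjugation_mat N W \<in> carrier_mat (N * N) (N * N)"
  by (simp add: conjugation_mat_def)

lemma dim_conjugation_mat [simp]:
  "dim_row (conjugation_mat N W) = N * N" "dim_col (conjugation_mat N W) = N * N"
  by (simp_all add: conjugation_mat_def)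

lemma conjugation_mat_mult:
  assumes V: "V \<in> carrier_mat N N" and W: "W \<in> carrier_mat N N"
  shows "conjugation_mat N V * conjugation_mat N W = conjugation_mat N (V * W)"
proof (rule eq_matI)
  fix a b assume "a < dim_row (conjugation_mat N (V * W))" "b < dim_col (conjugation_mat N (V * W))"
  then have ab: "a < N * N" "b < N * N" by (auto simp: conjugation_mat_def)
  note bd = div_mod_bounds[OF ab(1)] div_mod_bounds[OF ab(2)]
  have "(conjugation_mat N V * conjugation_mat N W) $$ (a, b) =
      (\<Sum>c<N * N. V $$ (a div N, c div N) * cnj (V $$ (a mod N, c mod N)) *
                  (W $$ (c div N, b div N) * cnj (W $$ (c mod N, b mod N))))"
    using ab by (subst index_mult_mat_sum[of _ "N * N" "N * N" _ "N * N"])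
                (auto simp: conjugation_mat_def)
  also have "\<dots> = (\<Sum>i<N. \<Sum>j<N. V $$ (a div N, i) * cnj (V $$ (a mod N, j)) *
                  (W $$ (i, b div N) * cnj (W $$ (j, b mod N))))"
    by (rule sum_div_mod[where f = "\<lambda>i j. V $$ (a div N, i) * cnj (V $$ (a mod N, j)) *
                  (W $$ (i, b div N) * cnj (W $$ (j, b mod N)))"])
  also have "\<dots> = (\<Sum>i<N. V $$ (a div N, i) * W $$ (i, b div N)) *
                  cnj (\<Sum>j<N. V $$ (a mod N, j) * W $$ (j, b mod N))"
    by (simp add: sum_product mult_ac)
  also have "\<dots> = conjugation_mat N (V * W) $$ (a, b)"
    using ab bd by (simp add: conjugation_mat_def index_mult_mat_sum[OF V W] del: index_mult_mat)
  finally show "(conjugation_mat N V * conjugation_mat N W) $$ (a, b) =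
    conjugation_mat N (V * W) $$ (a, b)" .
qed (auto simp: conjugation_mat_def)

lemma conjugation_mat_one: "conjugation_mat N (1\<^sub>m N) = 1\<^sub>m (N * N)"
proof (rule eq_matI)
  fix a b assume "a < dim_row (1\<^sub>m (N * N))" "b < dim_col (1\<^sub>m (N * N))"
  then have ab: "a < N * N" "b < N * N" by auto
  have "a div N = b div N \<and> a mod N = b mod N \<longleftrightarrow> a = b"
    by (metis div_mult_mod_eq)
  then show "conjugation_mat N (1\<^sub>m N) $$ (a, b) = 1\<^sub>m (N * N) $$ (a, b)"
    using ab div_mod_bounds[OF ab(1)] div_mod_bounds[OF ab(2)] by (auto simp: conjugation_mat_def)
qed (auto simp: conjugation_mat_def)

lemma conjugation_mat_adjoint:
  assumes "W \<in> carrier_mat N N"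
  shows "mat_adjoint (conjugation_mat N W) = conjugation_mat N (mat_adjoint W)"
proof (rule eq_matI)
  fix a b assume "a < dim_row (conjugation_mat N (mat_adjoint W))"
    "b < dim_col (conjugation_mat N (mat_adjoint W))"
  then have ab: "a < N * N" "b < N * N" by (auto simp: conjugation_mat_def)
  then show "mat_adjoint (conjugation_mat N W) $$ (a, b) = conjugation_mat N (mat_adjoint W) $$ (a, b)"
    using div_mod_bounds[OF ab(1)] div_mod_bounds[OF ab(2)]
    by (subst mat_adjoint_index[of _ "N * N" "N * N"])
       (auto simp: conjugation_mat_def mat_adjoint_index[OF assms])
qed (use mat_adjoint_carrier[of "conjugation_mat N W" "N * N" "N * N"] in
      \<open>auto simp: conjugation_mat_def\<close>)

text \<open>This is where positivity comes from: an operator that is a sum of conjugations has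
  nonnegative trace, so dropping terms from such a sum only decreases the trace.\<close>
lemma trace_conjugation_mat:
  assumes "W \<in> carrier_mat N N"
  shows "trace_mat (conjugation_mat N W) = of_real ((cmod (trace_mat W))\<^sup>2)"
proof -
  have "trace_mat (conjugation_mat N W) =
      (\<Sum>a<N * N. W $$ (a div N, a div N) * cnj (W $$ (a mod N, a mod N)))"
    by (simp add: trace_mat_def conjugation_mat_def)
  also have "\<dots> = (\<Sum>i<N. \<Sum>j<N. W $$ (i, i) * cnj (W $$ (j, j)))"
    by (rule sum_div_mod[where f = "\<lambda>i j. W $$ (i, i) * cnj (W $$ (j, j))"])
  also have "\<dots> = trace_mat W * cnj (trace_mat W)"
    using assms by (simp add: trace_mat_def sum_product)
  finally show ?thesis by (simp add: complex_norm_square del: of_real_power)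
qed

lemma unitary_conjugation_mat:
  assumes "unitary_mat N U"
  shows "unitary_mat (N * N) (conjugation_mat N U)"
  using assms unfolding unitary_mat_def
  by (auto simp: conjugation_mat_adjoint conjugation_mat_mult conjugation_mat_one mat_adjoint_carrier)

lemma unitary_mat_adjoint: "unitary_mat N U \<Longrightarrow> unitary_mat N (mat_adjoint U)"
  unfolding unitary_mat_def using mat_adjoint_adjoint[of U N N] by (auto simp: mat_adjoint_carrier)

section \<open>The matrix of the expander operator\<close>

definition coord :: "nat \<Rightarrow> complex mat \<Rightarrow> nat \<Rightarrow> complex" where
  "coord N M a = M $$ (a div N, a mod N)"

lemma coord_conjugate:
  assumes W: "W \<in> carrier_mat N N" and M: "M \<in> carrier_mat N N" and a: "a < N * N"
  shows "coord N (W * M * mat_adjoint W) a = (\<Sum>b<N * N. conjugation_mat N W $$ (a, b) * coord N M b)"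
proof -
  note bd = div_mod_bounds[OF a]
  note W' = mat_adjoint_carrier[OF W]
  have WM: "W * M \<in> carrier_mat N N" using W M by simp
  have "coord N (W * M * mat_adjoint W) a =
      (\<Sum>l<N. (\<Sum>k<N. W $$ (a div N, k) * M $$ (k, l)) * cnj (W $$ (a mod N, l)))"
    unfolding coord_def using bd
    by (simp add: index_mult_mat_sum[OF WM W'] index_mult_mat_sum[OF W M] mat_adjoint_index[OF W]
        del: index_mult_mat)
  also have "\<dots> = (\<Sum>k<N. \<Sum>l<N. W $$ (a div N, k) * cnj (W $$ (a mod N, l)) * M $$ (k, l))"
    unfolding sum_distrib_right by (subst sum.swap) (simp add: mult_ac)
  also have "\<dots> = (\<Sum>b<N * N. W $$ (a div N, b div N) * cnj (W $$ (a mod N, b mod N)) *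
                      M $$ (b div N, b mod N))"
    by (rule sum_div_mod[symmetric])
  also have "\<dots> = (\<Sum>b<N * N. conjugation_mat N W $$ (a, b) * coord N M b)"
    using a by (intro sum.cong) (auto simp: conjugation_mat_def coord_def)
  finally show ?thesis .
qed

lemma hs_inner_coord:
  assumes A: "A \<in> carrier_mat N N" and B: "B \<in> carrier_mat N N"
  shows "hs_inner A B = (\<Sum>a<N * N. coord N A a * cnj (coord N B a))"
proof -
  have "hs_inner A B = (\<Sum>i<N. \<Sum>k<N. A $$ (i, k) * cnj (B $$ (i, k)))"
    unfolding hs_inner_def trace_mat_mult_sum[OF A mat_adjoint_carrier[OF B]]
    by (intro sum.cong) (auto simp: mat_adjoint_index[OF B])
  also have "\<dots> = (\<Sum>a<N * N. coord N A a * cnj (coord N B a))"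
    unfolding coord_def by (rule sum_div_mod[symmetric])
  finally show ?thesis .
qed

lemma matrix_unit_carrier: "matrix_unit N b \<in> carrier_mat N N"
  by (simp add: matrix_unit_def)

lemma coord_matrix_unit:
  assumes "a < N * N"
  shows "coord N (matrix_unit N b) a = (if a = b then 1 else 0)"
proof -
  have "a div N = b div N \<and> a mod N = b mod N \<longleftrightarrow> a = b"
    by (metis div_mult_mod_eq)
  then show ?thesis using div_mod_bounds[OF assms] by (auto simp: coord_def matrix_unit_def)
qed

text \<open>The adjoint is chosen by Hilbert's operator, so an adjoint has to be exhibited first. After that no
  formula for it is used: its coordinates are inner products with the matrix units, and
  moving \<open>T\<close> across the inner product turns them into Gram entries of the columns of the matrix of \<open>T\<close>.\<close>
lemma operator_mat_adjoint_comp: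
  assumes T: "\<And>M. M \<in> carrier_mat N N \<Longrightarrow> T M \<in> carrier_mat N N"
    and lin: "\<And>M a. M \<in> carrier_mat N N \<Longrightarrow> a < N * N \<Longrightarrow>
      coord N (T M) a = (\<Sum>b<N * N. operator_mat N T $$ (a, b) * coord N M b)"
  shows "operator_mat N (hs_adjoint N T \<circ> T) = mat_adjoint (operator_mat N T) * operator_mat N T"
proof -
  define A where "A = operator_mat N T"
  have A: "A \<in> carrier_mat (N * N) (N * N)" by (simp add: A_def operator_mat_def)
  have Aix: "A $$ (a, b) = coord N (T (matrix_unit N b)) a" if "a < N * N" "b < N * N" for a b
    using that by (simp add: A_def operator_mat_def coord_def)
  define S0 where "S0 = (\<lambda>B. mat N N (\<lambda>(i, j). \<Sum>a<N * N. cnj (A $$ (a, i * N + j)) * coord N B a))"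
  have S0: "coord N (S0 B) b = (\<Sum>a<N * N. cnj (A $$ (a, b)) * coord N B a)" if "b < N * N" for B b
    using div_mod_bounds[OF that] by (simp add: S0_def coord_def)
  have ex: "\<forall>B \<in> carrier_mat N N. S0 B \<in> carrier_mat N N \<and>
      (\<forall>M \<in> carrier_mat N N. hs_inner (T M) B = hs_inner M (S0 B))"
  proof (intro ballI conjI)
    fix B M :: "complex mat" assume B: "B \<in> carrier_mat N N" and M: "M \<in> carrier_mat N N"
    have S0B: "S0 B \<in> carrier_mat N N" by (simp add: S0_def)
    have "hs_inner (T M) B =
        (\<Sum>a<N * N. \<Sum>b<N * N. A $$ (a, b) * coord N M b * cnj (coord N B a))"
      by (simp add: hs_inner_coord[OF T[OF M] B] lin[OF M] sum_distrib_right A_def)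
    also have "\<dots> = hs_inner M (S0 B)"
      unfolding hs_inner_coord[OF M S0B]
      by (subst sum.swap) (simp add: S0 sum_distrib_left mult_ac)
    finally show "hs_inner (T M) B = hs_inner M (S0 B)" .
  qed (simp add: S0_def)
  define S where "S = hs_adjoint N T"
  have S: "\<forall>B \<in> carrier_mat N N. S B \<in> carrier_mat N N \<and>
      (\<forall>M \<in> carrier_mat N N. hs_inner (T M) B = hs_inner M (S B))"
    unfolding S_def hs_adjoint_def by (rule someI[of _ S0]) (fact ex)
  have "operator_mat N (S \<circ> T) = mat_adjoint A * A"
  proof (rule eq_matI)
    fix a b assume "a < dim_row (mat_adjoint A * A)" "b < dim_col (mat_adjoint A * A)"
    then have ab: "a < N * N" "b < N * N" using A mat_adjoint_carrier[OF A] by auto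
    note E = matrix_unit_carrier
    have carr: "S (T (matrix_unit N b)) \<in> carrier_mat N N" using S T[OF E] by blast
    have "cnj (coord N (S (T (matrix_unit N b))) a) =
        (\<Sum>c<N * N. if c = a then cnj (coord N (S (T (matrix_unit N b))) c) else 0)"
      using ab by simp
    also have "\<dots> = hs_inner (matrix_unit N a) (S (T (matrix_unit N b)))"
      unfolding hs_inner_coord[OF E carr]
      by (intro sum.cong) (auto simp: coord_matrix_unit)
    also have "\<dots> = hs_inner (T (matrix_unit N a)) (T (matrix_unit N b))"
      using S T[OF E] E by metis
    also have "\<dots> = (\<Sum>c<N * N. A $$ (c, a) * cnj (A $$ (c, b)))"
      unfolding hs_inner_coord[OF T[OF E] T[OF E]] using ab by (simp add: Aix)
    finally have "coord N (S (T (matrix_unit N b))) a = (\<Sum>c<N * N. cnj (A $$ (c, a)) * A $$ (c, b))"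
      by (subst complex_cnj_cancel_iff[symmetric]) simp
    also have "\<dots> = (mat_adjoint A * A) $$ (a, b)"
      using ab by (simp add: index_mult_mat_sum[OF mat_adjoint_carrier[OF A] A]
          mat_adjoint_index[OF A] del: index_mult_mat)
    finally show "operator_mat N (S \<circ> T) $$ (a, b) = (mat_adjoint A * A) $$ (a, b)"
      using ab by (simp add: operator_mat_def coord_def)
  qed (use A mat_adjoint_carrier[OF A] in \<open>auto simp: operator_mat_def\<close>)
  then show ?thesis by (simp add: S_def A_def)
qed

definition avg_mat :: "nat \<Rightarrow> nat \<Rightarrow> (nat \<Rightarrow> complex mat) \<Rightarrow> complex mat" where
  "avg_mat n d K = mat n n (\<lambda>ij. 1 / of_nat d * (\<Sum>s = 1..d. K s $$ ij))"

lemma avg_mat_carrier [simp]: "avg_mat n d K \<in> carrier_mat n n"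
  by (simp add: avg_mat_def)

lemma expander_op_coord:
  assumes U: "\<And>s. s \<in> {1..d} \<Longrightarrow> U s \<in> carrier_mat N N" and M: "M \<in> carrier_mat N N" and a: "a < N * N"
  shows "coord N (expander_op N d U M) a =
    (\<Sum>b<N * N. avg_mat (N * N) d (\<lambda>s. conjugation_mat N (mat_adjoint (U s))) $$ (a, b) * coord N M b)"
proof -
  have "coord N (mat_adjoint (U s) * M * U s) a =
      (\<Sum>b<N * N. conjugation_mat N (mat_adjoint (U s)) $$ (a, b) * coord N M b)" if "s \<in> {1..d}" for s
    using coord_conjugate[OF mat_adjoint_carrier[OF U[OF that]] M a] mat_adjoint_adjoint[OF U[OF that]]
    by simp
  then have "coord N (expander_op N d U M) a = 1 / of_nat d * (\<Sum>s = 1..d.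
      \<Sum>b<N * N. conjugation_mat N (mat_adjoint (U s)) $$ (a, b) * coord N M b)"
    using div_mod_bounds[OF a] by (simp add: expander_op_def coord_def)
  also have "\<dots> = (\<Sum>b<N * N. avg_mat (N * N) d (\<lambda>s. conjugation_mat N (mat_adjoint (U s))) $$ (a, b) *
      coord N M b)"
    using a by (subst sum.swap) (simp add: avg_mat_def sum_distrib_left sum_distrib_right)
  finally show ?thesis .
qed

lemma operator_mat_expander_op:
  assumes U: "\<And>s. s \<in> {1..d} \<Longrightarrow> U s \<in> carrier_mat N N"
  shows "operator_mat N (expander_op N d U) =
    avg_mat (N * N) d (\<lambda>s. conjugation_mat N (mat_adjoint (U s)))" (is "_ = ?A")
proof (rule eq_matI)
  fix a b assume "a < dim_row ?A" "b < dim_col ?A"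
  then have ab: "a < N * N" "b < N * N" by (auto simp: avg_mat_def)
  have "operator_mat N (expander_op N d U) $$ (a, b) =
      coord N (expander_op N d U (matrix_unit N b)) a"
    using ab by (simp add: operator_mat_def coord_def)
  also have "\<dots> = (\<Sum>c<N * N. ?A $$ (a, c) * coord N (matrix_unit N b) c)"
    by (rule expander_op_coord[OF U matrix_unit_carrier ab(1)])
  also have "\<dots> = (\<Sum>c<N * N. if c = b then ?A $$ (a, b) else 0)"
    by (intro sum.cong) (auto simp: coord_matrix_unit)
  finally show "operator_mat N (expander_op N d U) $$ (a, b) = ?A $$ (a, b)" using ab by simp
qed (auto simp: operator_mat_def avg_mat_def)

lemma operator_mat_expander_gram:
  assumes U: "\<And>s. s \<in> {1..d} \<Longrightarrow> U s \<in> carrier_mat N N"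
  defines "A \<equiv> avg_mat (N * N) d (\<lambda>s. conjugation_mat N (mat_adjoint (U s)))"
  shows "operator_mat N (hs_adjoint N (expander_op N d U) \<circ> expander_op N d U) = mat_adjoint A * A"
proof -
  have carr: "expander_op N d U M \<in> carrier_mat N N" for M by (simp add: expander_op_def)
  have A: "operator_mat N (expander_op N d U) = A"
    unfolding A_def by (rule operator_mat_expander_op[OF U])
  show ?thesis
    unfolding A[symmetric]
  proof (rule operator_mat_adjoint_comp[OF carr])
    fix M :: "complex mat" and a assume M: "M \<in> carrier_mat N N" and a: "a < N * N"
    show "coord N (expander_op N d U M) a =
        (\<Sum>b<N * N. operator_mat N (expander_op N d U) $$ (a, b) * coord N M b)"
      unfolding A unfolding A_def by (rule expander_op_coord[OF U M a])
  qed
qed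

section \<open>Ballot numbers\<close>

text \<open>For \<open>2 * j \<le> n\<close> this is the number of walks on the nonnegative integers that start at height \<open>n - 2 * j\<close>,
  take \<open>j\<close> steps up and \<open>n - j\<close> steps down, and so end at 0. The closed form, due to the
  reflection principle, makes Pascal's rule the recursion over the first step.\<close>
definition ballot :: "nat \<Rightarrow> nat \<Rightarrow> real" where
  "ballot n j = real (n choose j) - (if j = 0 then 0 else real (n choose (j - 1)))"

lemma ballot_0 [simp]: "ballot n 0 = 1"
  by (simp add: ballot_def)

lemma ballot_Suc_Suc: "ballot (Suc n) (Suc j) = ballot n (Suc j) + ballot n j"
  by (cases j) (auto simp: ballot_def)

text \<open>The boundary case of the recursion: a walk at height 0 cannot begin with a step down.\<close>
lemma ballot_odd_central: "ballot (Suc (2 * j)) (Suc j) = 0"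
  using binomial_symmetric[of j "Suc (2 * j)"] by (simp add: ballot_def)

lemma ballot_central: "ballot (2 * p) p = real ((2 * p) choose p) / (real p + 1)"
proof (cases p)
  case (Suc q)
  have "real (2 * p - q) * real ((2 * p) choose q) = real (Suc q) * real ((2 * p) choose Suc q)"
    using binomial_absorb_comp[of "2 * p" q] binomial_absorption[of q "2 * p - 1"] Suc
    by (metis (no_types, lifting) binomial_absorb_comp binomial_absorption of_nat_mult mult_2 add_Suc diff_Suc_1)
  then have "(real p + 1) * real ((2 * p) choose q) = real p * real ((2 * p) choose p)"
    using Suc by (simp add: algebra_simps of_nat_diff)
  then show ?thesis using Suc by (simp add: ballot_def field_simps)
qed simp

text \<open>The bound with \<open>p\<close> in place of \<open>sqrt p\<close> would be easier but costs a factor \<open>sqrt p\<close>, and with it the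
  exponent 3/2 of the logarithm. In the step, the ratio of consecutive coefficients is
  \<open>2 * (2 * p + 1) / (p + 1)\<close>, and \<open>4 * p * (p + 1) \<le> (2 * p + 1)^2\<close> compares it with the ratio of the square roots.\<close>
lemma central_binomial_sqrt_bound:
  assumes "p \<ge> 1"
  shows "4 ^ p \<le> 2 * sqrt (real p) * real ((2 * p) choose p)"
  using assms
proof (induction p rule: dec_induct)
  case (step p)
  define c where "c = real ((2 * p) choose p)"
  have c: "real ((2 * Suc p) choose Suc p) * (real p + 1) = 2 * (2 * real p + 1) * c"
  proof -
    have 1: "Suc p * ((2 * Suc p) choose Suc p) = Suc (2 * p + 1) * ((2 * p + 1) choose p)"
      using binomial_absorption[of p "2 * Suc p"] by (simp del: binomial_Suc_Suc)
    have 2: "(p + 1) * ((2 * p + 1) choose p) = (2 * p + 1) * ((2 * p) choose p)"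
      using binomial_absorb_comp[of "2 * p + 1" p] by simp
    have "real (Suc p) * real ((2 * Suc p) choose Suc p) = 2 * (real p + 1) * real ((2 * p + 1) choose p)"
      using arg_cong[OF 1, of real] unfolding of_nat_mult by (simp add: algebra_simps)
    moreover have "(real p + 1) * real ((2 * p + 1) choose p) = (2 * real p + 1) * c"
      using arg_cong[OF 2, of real] unfolding of_nat_mult c_def by (simp add: algebra_simps)
    ultimately show ?thesis by (simp add: algebra_simps)
  qed
  have p: "real p \<ge> 1" using step by simp
  have le: "2 * sqrt (real p) * (real p + 1) \<le> sqrt (real p + 1) * (2 * real p + 1)"
  proof (rule power2_le_imp_le)
    show "(2 * sqrt (real p) * (real p + 1))\<^sup>2 \<le> (sqrt (real p + 1) * (2 * real p + 1))\<^sup>2"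
      using p by (simp add: power_mult_distrib) (simp add: power2_eq_square algebra_simps)
  qed (use p in auto)
  have "4 ^ Suc p * (real p + 1) \<le> 4 * (2 * sqrt (real p) * c) * (real p + 1)"
    using step.IH p by (simp add: c_def)
  also have "\<dots> = 4 * c * (2 * sqrt (real p) * (real p + 1))" by simp
  also have "\<dots> \<le> 4 * c * (sqrt (real p + 1) * (2 * real p + 1))"
    by (intro mult_left_mono le) (simp add: c_def)
  also have "\<dots> = 2 * sqrt (real (Suc p)) * (real ((2 * Suc p) choose Suc p) * (real p + 1))"
    unfolding c by (simp add: algebra_simps)
  also have "\<dots> = 2 * sqrt (real (Suc p)) * real ((2 * Suc p) choose Suc p) * (real p + 1)"
    by simp
  finally show ?case
    by (rule mult_right_le_imp_le) simp
qed simp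

lemma ballot_central_bound:
  assumes "p \<ge> 1"
  shows "4 ^ p \<le> 4 * real p powr (3 / 2) * ballot (2 * p) p"
proof -
  have p: "real p \<ge> 1" using assms by simp
  have pw: "real p powr (3 / 2) = sqrt (real p) * real p"
    using p by (simp add: powr_half_sqrt[symmetric] powr_mult_base mult.commute)
  have "4 ^ p \<le> 2 * sqrt (real p) * real ((2 * p) choose p)"
    by (rule central_binomial_sqrt_bound[OF assms])
  also have "\<dots> = 2 * sqrt (real p) * (real p + 1) * ballot (2 * p) p"
    by (simp add: ballot_central)
  also have "\<dots> \<le> 4 * real p powr (3 / 2) * ballot (2 * p) p"
    unfolding pw
  proof (intro mult_right_mono)
    show "2 * sqrt (real p) * (real p + 1) \<le> 4 * (sqrt (real p) * real p)"
      using p mult_left_mono[of "real p + 1" "2 * real p" "2 * sqrt (real p)"] by (simp add: mult_ac)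
  qed (simp add: ballot_central)
  finally show ?thesis .
qed

section \<open>Traces of alternating words\<close>

definition letter :: "(nat \<Rightarrow> complex mat) \<Rightarrow> bool \<Rightarrow> nat \<Rightarrow> complex mat" where
  "letter K b s = (if b then K s else mat_adjoint (K s))"

text \<open>The first letter of a word is starred unless \<open>b\<close> holds, and stars alternate; an alternating power is
  indexed by the status of its last factor instead. Thus a power ending in status \<open>b\<close> matches a word that
  begins with status \<open>\<not> b\<close>: the last factor can be expanded into letters that prolong the word to the left.\<close>
fun alternating_word :: "nat \<Rightarrow> (nat \<Rightarrow> complex mat) \<Rightarrow> bool \<Rightarrow> nat list \<Rightarrow> complex mat" where
  "alternating_word n K b [] = 1\<^sub>m n"
| "alternating_word n K b (s # r) = letter K b s * alternating_word n K (\<not> b) r"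

fun alternating_power :: "nat \<Rightarrow> complex mat \<Rightarrow> bool \<Rightarrow> nat \<Rightarrow> complex mat" where
  "alternating_power n A b 0 = 1\<^sub>m n"
| "alternating_power n A b (Suc k) = alternating_power n A (\<not> b) k * (if b then A else mat_adjoint A)"

lemma alternating_power_carrier:
  "A \<in> carrier_mat n n \<Longrightarrow> alternating_power n A b k \<in> carrier_mat n n"
  by (induction k arbitrary: b) (auto intro!: mult_carrier_mat[of _ n n] simp: mat_adjoint_carrier)

lemma alternating_power_even:
  assumes A: "A \<in> carrier_mat n n"
  shows "alternating_power n A True (2 * p) = (mat_adjoint A * A) ^\<^sub>m p"
proof (induction p)
  case (Suc p)
  have "mat_adjoint A * A \<in> carrier_mat n n" using A mat_adjoint_carrier[OF A] by simp
  then have "(mat_adjoint A * A) ^\<^sub>m p \<in> carrier_mat n n" by simp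
  then show ?case using Suc A mat_adjoint_carrier[OF A] by (simp add: assoc_mult_mat[of _ n n _ n _ n])
qed (use A mat_adjoint_carrier[OF A] in auto)

lemma trace_avg_mat_mult:
  assumes K: "\<And>s. s \<in> {1..d} \<Longrightarrow> K s \<in> carrier_mat n n" and Q: "Q \<in> carrier_mat n n"
  shows "trace_mat (avg_mat n d K * Q) = 1 / of_nat d * (\<Sum>s = 1..d. trace_mat (K s * Q))"
proof -
  have "trace_mat (avg_mat n d K * Q) =
      (\<Sum>i<n. \<Sum>k<n. 1 / of_nat d * (\<Sum>s = 1..d. K s $$ (i, k)) * Q $$ (k, i))"
    unfolding trace_mat_mult_sum[OF avg_mat_carrier Q]
    by (intro sum.cong) (auto simp: avg_mat_def)
  also have "\<dots> = (\<Sum>i<n. \<Sum>k<n. \<Sum>s = 1..d. 1 / of_nat d * K s $$ (i, k) * Q $$ (k, i))"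
    by (simp add: sum_distrib_left sum_distrib_right)
  also have "\<dots> = (\<Sum>i<n. \<Sum>s = 1..d. \<Sum>k<n. 1 / of_nat d * K s $$ (i, k) * Q $$ (k, i))"
    by (intro sum.cong refl sum.swap)
  also have "\<dots> = (\<Sum>s = 1..d. \<Sum>i<n. \<Sum>k<n. 1 / of_nat d * K s $$ (i, k) * Q $$ (k, i))"
    by (rule sum.swap)
  also have "\<dots> = 1 / of_nat d * (\<Sum>s = 1..d. \<Sum>i<n. \<Sum>k<n. K s $$ (i, k) * Q $$ (k, i))"
    by (simp add: sum_distrib_left)
  also have "\<dots> = 1 / of_nat d * (\<Sum>s = 1..d. trace_mat (K s * Q))"
    using trace_mat_mult_sum[OF K Q] by simp
  finally show ?thesis .
qed

lemma mat_adjoint_avg_mat: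
  assumes K: "\<And>s. s \<in> {1..d} \<Longrightarrow> K s \<in> carrier_mat n n"
  shows "mat_adjoint (avg_mat n d K) = avg_mat n d (\<lambda>s. mat_adjoint (K s))"
proof (rule eq_matI)
  fix i j assume "i < dim_row (avg_mat n d (\<lambda>s. mat_adjoint (K s)))"
    "j < dim_col (avg_mat n d (\<lambda>s. mat_adjoint (K s)))"
  then have ij: "i < n" "j < n" by (auto simp: avg_mat_def)
  then show "mat_adjoint (avg_mat n d K) $$ (i, j) = avg_mat n d (\<lambda>s. mat_adjoint (K s)) $$ (i, j)"
    by (subst mat_adjoint_index[OF avg_mat_carrier]) (auto simp: avg_mat_def mat_adjoint_index[OF K])
qed (use mat_adjoint_carrier[OF avg_mat_carrier[of n d K]] in \<open>auto simp: avg_mat_def\<close>)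

context
  fixes n d :: nat and K :: "nat \<Rightarrow> complex mat"
  assumes unitary: "\<And>s. s \<in> {1..d} \<Longrightarrow> unitary_mat n (K s)"
begin

private lemma K_carrier: "s \<in> {1..d} \<Longrightarrow> K s \<in> carrier_mat n n"
  using unitary by (simp add: unitary_mat_def)

lemma letter_carrier: "s \<in> {1..d} \<Longrightarrow> letter K b s \<in> carrier_mat n n"
  by (simp add: letter_def K_carrier mat_adjoint_carrier)

lemma letter_cancel: "s \<in> {1..d} \<Longrightarrow> letter K b s * letter K (\<not> b) s = 1\<^sub>m n"
  using unitary by (simp add: letter_def unitary_mat_def)

lemma alternating_word_carrier: "set r \<subseteq> {1..d} \<Longrightarrow> alternating_word n K b r \<in> carrier_mat n n"
  by (induction r arbitrary: b) (auto intro!: mult_carrier_mat letter_carrier)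

text \<open>Because stars alternate, two equal neighbours are a unitary matrix and its adjoint.\<close>
lemma alternating_word_cancel:
  assumes "set (t # r) \<subseteq> {1..d}"
  shows "alternating_word n K b (t # t # r) = alternating_word n K b r"
proof -
  have t: "t \<in> {1..d}" using assms by simp
  have W: "alternating_word n K b r \<in> carrier_mat n n" using assms by (intro alternating_word_carrier) auto
  have "alternating_word n K b (t # t # r) =
      letter K b t * letter K (\<not> b) t * alternating_word n K b r"
    using assoc_mult_mat[OF letter_carrier[OF t] letter_carrier[OF t] W] by simp
  then show ?thesis using letter_cancel[OF t] W by simp
qed

lemma trace_alternating_power_Suc:
  assumes r: "set r \<subseteq> {1..d}"
  shows "trace_mat (alternating_power n (avg_mat n d K) b (Suc k) * alternating_word n K (\<not> b) r) =
    1 / of_nat d * (\<Sum>s = 1..d. trace_mat (alternating_power n (avg_mat n d K) (\<not> b) k *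
      alternating_word n K b (s # r)))"
proof -
  define P where "P = alternating_power n (avg_mat n d K) (\<not> b) k"
  define W where "W = alternating_word n K (\<not> b) r"
  define L where "L = avg_mat n d (letter K b)"
  have P: "P \<in> carrier_mat n n" unfolding P_def by (intro alternating_power_carrier) simp
  have W: "W \<in> carrier_mat n n" unfolding W_def by (rule alternating_word_carrier[OF r])
  have L: "L \<in> carrier_mat n n" by (simp add: L_def)
  have "(if b then avg_mat n d K else mat_adjoint (avg_mat n d K)) = L"
    unfolding L_def letter_def using mat_adjoint_avg_mat[OF K_carrier] by simp
  then have "trace_mat (alternating_power n (avg_mat n d K) b (Suc k) * W) = trace_mat (P * L * W)"
    by (simp add: P_def)
  also have "\<dots> = trace_mat (P * (L * W))" using P L W by simp
  also have "\<dots> = trace_mat (L * W * P)" using P L W by (intro trace_mat_comm[of _ n n]) auto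
  also have "\<dots> = trace_mat (L * (W * P))" using P L W by simp
  also have "\<dots> = 1 / of_nat d * (\<Sum>s = 1..d. trace_mat (letter K b s * (W * P)))"
    unfolding L_def using W P by (intro trace_avg_mat_mult) (auto intro: letter_carrier)
  also have "(\<Sum>s = 1..d. trace_mat (letter K b s * (W * P))) =
      (\<Sum>s = 1..d. trace_mat (P * alternating_word n K b (s # r)))"
  proof (intro sum.cong refl)
    fix s assume s: "s \<in> {1..d}"
    note l = letter_carrier[OF s, of b]
    have "trace_mat (letter K b s * (W * P)) = trace_mat (letter K b s * W * P)"
      using assoc_mult_mat[OF l W P] by simp
    also have "\<dots> = trace_mat (P * (letter K b s * W))"
      using l W P by (intro trace_mat_comm[of _ n n]) auto
    finally show "trace_mat (letter K b s * (W * P)) = trace_mat (P * alternating_word n K b (s # r))"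
      by (simp add: W_def)
  qed
  finally show ?thesis by (simp add: W_def P_def)
qed

text \<open>The word \<open>r\<close> acts as a stack, or as the path from a vertex of the \<open>d\<close>-regular tree back to the
  root. Up to the factor \<open>d ^ k\<close>, \<open>returns b k r\<close> is the sum of the traces over all walks of \<open>k\<close> further
  steps from that vertex.\<close>
context
  assumes positive: "\<And>b r. set r \<subseteq> {1..d} \<Longrightarrow> 0 \<le> Re (trace_mat (alternating_word n K b r))"
begin

abbreviation "returns b k r \<equiv>
  Re (trace_mat (alternating_power n (avg_mat n d K) b k * alternating_word n K (\<not> b) r))"

lemma returns_Suc:
  assumes "set r \<subseteq> {1..d}"
  shows "returns b (Suc k) r = (\<Sum>s = 1..d. returns (\<not> b) k (s # r)) / real d"
  unfolding trace_alternating_power_Suc[OF assms]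
  by (simp add: Re_divide_of_nat del: alternating_word.simps)

lemma returns_nonneg: "set r \<subseteq> {1..d} \<Longrightarrow> 0 \<le> returns b k r"
proof (induction k arbitrary: b r)
  case 0
  then show ?case using positive[OF 0] left_mult_one_mat[OF alternating_word_carrier[OF 0]] by simp
next
  case (Suc k)
  have "0 \<le> returns (\<not> b) k (s # r)" if "s \<in> {1..d}" for s
    using that Suc.prems by (intro Suc.IH) auto
  then show ?case unfolding returns_Suc[OF Suc.prems]
    by (intro divide_nonneg_nonneg sum_nonneg) (auto simp del: alternating_word.simps)
qed

text \<open>From a vertex at distance \<open>length r\<close> of the root, count only the walks that end at the root; the
  others contribute nonnegative traces. One of the \<open>d\<close> possible steps pops the stack and at least \<open>d - 1\<close> push
  a letter, which is the recursion of the ballot numbers with weight \<open>d - 1\<close> per push. Cancellations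
  inside \<open>r\<close> itself do not affect this count of stack operations.\<close>
lemma returns_lower_bound:
  assumes "set r \<subseteq> {1..d}" "k = length r + 2 * j" "d \<ge> 1"
  shows "real n * ballot k j * (real d - 1) ^ j / real d ^ k \<le> returns b k r"
  using assms(1,2)
proof (induction k arbitrary: b r j)
  case 0
  then show ?case by (simp add: trace_mat_one)
next
  case (Suc k)
  define D where "D = real d - 1"
  define m where "m = real n / real d ^ k"
  have IH: "m * ballot k i * D ^ i \<le> returns (\<not> b) k q"
    if "set q \<subseteq> {1..d}" "k = length q + 2 * i" for q i
    using Suc.IH[OF that, of "\<not> b"] by (simp add: m_def D_def)
  have nn: "0 \<le> returns (\<not> b) k (s # r)" if "s \<in> {1..d}" for s
    using that Suc.prems(1) by (intro returns_nonneg) auto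
  \<comment> \<open>The letter \<open>t\<close> is the top of the stack. At the root every step pushes; there the ballot number
    vanishes, so any letter can play this role.\<close>
  have "\<exists>t\<in>{1..d}. m * ballot k j * D ^ j \<le> returns (\<not> b) k (t # r)"
  proof (cases r)
    case Nil
    then obtain i where "j = Suc i" "k = Suc (2 * i)"
      using Suc.prems(2) by (cases j) auto
    then show ?thesis
      using nn[of 1] Nil assms(3) by (auto simp: ballot_odd_central simp del: alternating_word.simps)
  next
    case (Cons t q)
    have t: "t \<in> {1..d}" and q: "set q \<subseteq> {1..d}" using Suc.prems Cons by auto
    have "alternating_word n K b (t # r) = alternating_word n K b q"
      unfolding Cons using t q by (intro alternating_word_cancel) auto
    then show ?thesis
      using IH[OF q, of j] Suc.prems(2) Cons t
      by (intro bexI[of _ t]) (auto simp del: alternating_word.simps)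
  qed
  then obtain t where t: "t \<in> {1..d}" and
    cancelled: "m * ballot k j * D ^ j \<le> returns (\<not> b) k (t # r)" by blast
  have extended: "(if j = 0 then 0 else m * ballot k (j - 1) * D ^ j) \<le>
      (\<Sum>s\<in>{1..d} - {t}. returns (\<not> b) k (s # r))"
  proof (cases j)
    case 0
    then show ?thesis
      using nn Suc.prems(1) by (auto intro!: sum_nonneg simp del: alternating_word.simps)
  next
    case (Suc i)
    have "real (card ({1..d} - {t})) = D" using t by (simp add: D_def of_nat_diff)
    moreover have "of_nat (card ({1..d} - {t})) * (m * ballot k i * D ^ i) \<le>
        (\<Sum>s\<in>{1..d} - {t}. returns (\<not> b) k (s # r))"
      using IH[of "_ # r" i] Suc.prems Suc
      by (intro sum_bounded_below) (auto simp del: alternating_word.simps)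
    ultimately show ?thesis using Suc by (simp add: mult_ac)
  qed
  have "m * ballot (Suc k) j * D ^ j =
      m * ballot k j * D ^ j + (if j = 0 then 0 else m * ballot k (j - 1) * D ^ j)"
    by (cases j) (auto simp: ballot_Suc_Suc algebra_simps)
  also have "\<dots> \<le> returns (\<not> b) k (t # r) + (\<Sum>s\<in>{1..d} - {t}. returns (\<not> b) k (s # r))"
    by (rule add_mono[OF cancelled extended])
  also have "\<dots> = (\<Sum>s = 1..d. returns (\<not> b) k (s # r))"
    using t by (subst (2) sum.remove[of _ t]) auto
  finally have key: "m * ballot (Suc k) j * D ^ j \<le> (\<Sum>s = 1..d. returns (\<not> b) k (s # r))" .
  show ?case unfolding returns_Suc[OF Suc.prems(1)]
    using divide_right_mono[OF key, of "real d"] by (simp add: m_def D_def field_simps)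
qed

lemma trace_gram_power_lower_bound:
  assumes "d \<ge> 1"
  shows "real n * ballot (2 * p) p * (real d - 1) ^ p / real d ^ (2 * p) \<le>
    Re (trace_mat ((mat_adjoint (avg_mat n d K) * avg_mat n d K) ^\<^sub>m p))"
proof -
  have "alternating_power n (avg_mat n d K) True (2 * p) \<in> carrier_mat n n"
    by (simp add: alternating_power_carrier)
  then show ?thesis
    using returns_lower_bound[of "[]" "2 * p" p True] assms
    by (simp add: alternating_power_even[OF avg_mat_carrier] right_mult_one_mat[of _ n n])
qed

end
end

section \<open>Power sums of eigenvalues\<close>

lemma upper_triangular_mult_index:
  fixes A B :: "complex mat"
  assumes A: "A \<in> carrier_mat n n" "upper_triangular A"
    and B: "B \<in> carrier_mat n n" "upper_triangular B"
    and "j \<le> i" "i < n"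
  shows "(A * B) $$ (i, j) = (if i = j then A $$ (i, i) * B $$ (i, i) else 0)"
proof -
  have "(A * B) $$ (i, j) = (\<Sum>k<n. A $$ (i, k) * B $$ (k, j))"
    using assms by (intro index_mult_mat_sum[OF A(1) B(1)]) auto
  also have "\<dots> = (\<Sum>k<n. if k = i then (if i = j then A $$ (i, i) * B $$ (i, i) else 0) else 0)"
  proof (intro sum.cong refl)
    fix k assume k: "k \<in> {..<n}"
    consider "k < i" | "k > j" "k \<ge> i" | "k = i" "i = j" using assms(5) by linarith
    then show "A $$ (i, k) * B $$ (k, j) =
        (if k = i then (if i = j then A $$ (i, i) * B $$ (i, i) else 0) else 0)"
      by cases (use assms k in \<open>auto simp: upper_triangularD\<close>)
  qed
  finally show ?thesis using assms by simp
qed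

lemma upper_triangular_pow:
  fixes T :: "complex mat"
  assumes T: "T \<in> carrier_mat n n" "upper_triangular T"
  shows "upper_triangular (T ^\<^sub>m p) \<and> (\<forall>i<n. (T ^\<^sub>m p) $$ (i, i) = T $$ (i, i) ^ p)"
proof (induction p)
  case 0
  then show ?case using T by auto
next
  case (Suc p)
  have Tp: "T ^\<^sub>m p \<in> carrier_mat n n" using T by simp
  note ix = upper_triangular_mult_index[OF Tp conjunct1[OF Suc] T]
  show ?case
  proof (intro conjI allI impI upper_triangularI)
    fix i j assume "j < i" "i < dim_row (T ^\<^sub>m Suc p)"
    then show "(T ^\<^sub>m Suc p) $$ (i, j) = 0" using ix[of j i] Tp T by simp
  next
    fix i assume "i < n"
    then show "(T ^\<^sub>m Suc p) $$ (i, i) = T $$ (i, i) ^ Suc p"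
      using ix[of i i] Suc by (simp add: mult.commute)
  qed
qed

lemma proots_linear_factors: "proots (\<Prod>a\<leftarrow>as. [:- a, 1:]) = mset (as :: complex list)"
proof (induction as)
  case (Cons a as)
  have "(\<Prod>a\<leftarrow>as. [:- a, 1:]) \<noteq> 0" by (auto simp: prod_list_zero_iff)
  then have "proots ([:- a, 1:] * (\<Prod>a\<leftarrow>as. [:- a, 1:])) = {#a#} + mset as"
    using Cons by (subst proots_mult) auto
  then show ?case by simp
qed simp

lemma trace_power_eq_sum_eigenvalues:
  assumes B: "B \<in> carrier_mat n n"
  shows "trace_mat (B ^\<^sub>m p) = (\<Sum>z\<in>#proots (char_poly B). z ^ p)"
proof -
  obtain es where es: "char_poly B = (\<Prod>a\<leftarrow>es. [:- a, 1:])" "length es = n"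
    using char_poly_factorized[OF B] by blast
  obtain T P Q where "schur_decomposition B es = (T, P, Q)"
    by (cases "schur_decomposition B es")
  from schur_decomposition[OF B es(1) this]
  have sim: "similar_mat_wit B T P Q" and T: "upper_triangular T" "diag_mat T = es" by auto
  note wit = similar_mat_witD2[OF B sim]
  have Tp: "T ^\<^sub>m p \<in> carrier_mat n n" using wit by simp
  have "trace_mat (B ^\<^sub>m p) = trace_mat (P * T ^\<^sub>m p * Q)"
    using similar_mat_wit_pow_id[OF sim] by simp
  also have "\<dots> = trace_mat (Q * (P * T ^\<^sub>m p))"
    using Tp wit by (intro trace_mat_comm[of _ n n] mult_carrier_mat[of _ n n])
  also have "Q * (P * T ^\<^sub>m p) = Q * P * T ^\<^sub>m p"
    using assoc_mult_mat[OF wit(7,6) Tp] by simp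
  also have "\<dots> = T ^\<^sub>m p" using Tp wit by simp
  also have "trace_mat (T ^\<^sub>m p) = (\<Sum>i<n. T $$ (i, i) ^ p)"
    using upper_triangular_pow[OF wit(5) T(1), of p] Tp wit(5) by (simp add: trace_mat_def)
  also have "\<dots> = (\<Sum>z\<leftarrow>es. z ^ p)"
    using wit(5) unfolding T(2)[symmetric] diag_mat_def
    by (simp add: comp_def lessThan_atLeast0 interv_sum_list_conv_sum_set_nat)
  also have "\<dots> = (\<Sum>z\<in>#proots (char_poly B). z ^ p)"
    unfolding es(1) proots_linear_factors by (simp flip: sum_mset_sum_list)
  finally show ?thesis .
qed

lemma Re_sum_mset: "Re (\<Sum>z\<in>#X. f z) = (\<Sum>z\<in>#X. Re (f z))"
  by (induction X) auto

lemma size_proots_char_poly: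
  fixes B :: "complex mat"
  assumes "B \<in> carrier_mat n n"
  shows "size (proots (char_poly B)) = n"
  using char_poly_factorized[OF assms] by (auto simp: proots_linear_factors)

section \<open>Averages of unitary matrices are contractions\<close>

lemma gram_quadratic_form:
  fixes A :: "complex mat"
  assumes A: "A \<in> carrier_mat n n" and v: "v \<in> carrier_vec n"
  shows "(\<Sum>a<n. cnj (v $ a) * ((mat_adjoint A * A) *\<^sub>v v) $ a) =
    of_real (\<Sum>c<n. (cmod ((A *\<^sub>v v) $ c))\<^sup>2)"
proof -
  note A' = mat_adjoint_carrier[OF A]
  have mv: "(M *\<^sub>v w) $ a = (\<Sum>b<n. M $$ (a, b) * w $ b)"
    if "M \<in> carrier_mat n n" "w \<in> carrier_vec n" "a < n" for M :: "complex mat" and w a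
    using that by (auto simp: scalar_prod_def lessThan_atLeast0 intro!: sum.cong)
  have Av: "A *\<^sub>v v \<in> carrier_vec n" using A v by simp
  have "(mat_adjoint A * A) *\<^sub>v v = mat_adjoint A *\<^sub>v (A *\<^sub>v v)"
    by (rule assoc_mult_mat_vec[OF A' A v])
  then have "(\<Sum>a<n. cnj (v $ a) * ((mat_adjoint A * A) *\<^sub>v v) $ a) =
      (\<Sum>a<n. \<Sum>c<n. cnj (v $ a) * (cnj (A $$ (c, a)) * (A *\<^sub>v v) $ c))"
    by (simp add: mv[OF A' Av] mat_adjoint_index[OF A] sum_distrib_left)
  also have "\<dots> = (\<Sum>c<n. cnj (\<Sum>a<n. A $$ (c, a) * v $ a) * (A *\<^sub>v v) $ c)"
    by (subst sum.swap) (simp add: sum_distrib_left sum_distrib_right mult_ac)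
  also have "\<dots> = (\<Sum>c<n. cnj ((A *\<^sub>v v) $ c) * (A *\<^sub>v v) $ c)"
    by (intro sum.cong) (auto simp: mv[OF A v])
  also have "\<dots> = of_real (\<Sum>c<n. (cmod ((A *\<^sub>v v) $ c))\<^sup>2)"
    by (simp add: complex_norm_square mult.commute del: of_real_power)
  finally show ?thesis .
qed

lemma unitary_norm:
  assumes U: "unitary_mat n U" and v: "v \<in> carrier_vec n"
  shows "(\<Sum>c<n. (cmod ((U *\<^sub>v v) $ c))\<^sup>2) = (\<Sum>c<n. (cmod (v $ c))\<^sup>2)"
proof -
  have carr: "U \<in> carrier_mat n n" and id: "(mat_adjoint U * U) *\<^sub>v v = v"
    using U v by (auto simp: unitary_mat_def)
  have "complex_of_real (\<Sum>c<n. (cmod ((U *\<^sub>v v) $ c))\<^sup>2) = (\<Sum>a<n. cnj (v $ a) * v $ a)"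
    unfolding gram_quadratic_form[OF carr v, symmetric] id ..
  also have "\<dots> = of_real (\<Sum>c<n. (cmod (v $ c))\<^sup>2)"
    by (simp add: complex_norm_square mult.commute del: of_real_power)
  finally show ?thesis by (simp only: of_real_eq_iff)
qed

lemma avg_unitary_contraction:
  assumes K: "\<And>s. s \<in> {1..d} \<Longrightarrow> unitary_mat n (K s)" and d: "d \<ge> 1" and v: "v \<in> carrier_vec n"
  shows "(\<Sum>c<n. (cmod ((avg_mat n d K *\<^sub>v v) $ c))\<^sup>2) \<le> (\<Sum>c<n. (cmod (v $ c))\<^sup>2)"
proof -
  have "(cmod ((avg_mat n d K *\<^sub>v v) $ c))\<^sup>2 \<le> (\<Sum>s = 1..d. (cmod ((K s *\<^sub>v v) $ c))\<^sup>2) / real d"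
    if c: "c < n" for c
  proof -
    have Kv: "(K s *\<^sub>v v) $ c = (\<Sum>b<n. K s $$ (c, b) * v $ b)" if "s \<in> {1..d}" for s
      using K[OF that] c v by (auto simp: unitary_mat_def scalar_prod_def lessThan_atLeast0 intro!: sum.cong)
    have "(avg_mat n d K *\<^sub>v v) $ c = (\<Sum>b<n. 1 / of_nat d * (\<Sum>s = 1..d. K s $$ (c, b)) * v $ b)"
      using c v by (auto simp: avg_mat_def scalar_prod_def lessThan_atLeast0 intro!: sum.cong)
    also have "\<dots> = 1 / of_nat d * (\<Sum>b<n. \<Sum>s = 1..d. K s $$ (c, b) * v $ b)"
      by (simp add: sum_distrib_left sum_distrib_right)
    also have "(\<Sum>b<n. \<Sum>s = 1..d. K s $$ (c, b) * v $ b) = (\<Sum>s = 1..d. (K s *\<^sub>v v) $ c)"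
      by (subst sum.swap) (simp add: Kv)
    finally have eq: "(avg_mat n d K *\<^sub>v v) $ c = 1 / of_nat d * (\<Sum>s = 1..d. (K s *\<^sub>v v) $ c)" .
    have "(cmod (\<Sum>s = 1..d. (K s *\<^sub>v v) $ c))\<^sup>2 \<le> (\<Sum>s = 1..d. cmod ((K s *\<^sub>v v) $ c))\<^sup>2"
      by (intro power_mono norm_sum) auto
    also have "\<dots> \<le> real d * (\<Sum>s = 1..d. (cmod ((K s *\<^sub>v v) $ c))\<^sup>2)"
      using sum_squared_le_sum_of_squares[of "\<lambda>s. cmod ((K s *\<^sub>v v) $ c)" "{1..d}"] by (simp add: mult.commute)
    finally show ?thesis
      unfolding eq using d by (simp add: norm_mult norm_divide power_mult_distrib power2_eq_square field_simps)
  qed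
  then have "(\<Sum>c<n. (cmod ((avg_mat n d K *\<^sub>v v) $ c))\<^sup>2) \<le>
      (\<Sum>c<n. (\<Sum>s = 1..d. (cmod ((K s *\<^sub>v v) $ c))\<^sup>2) / real d)"
    by (intro sum_mono) auto
  also have "\<dots> = (\<Sum>s = 1..d. \<Sum>c<n. (cmod ((K s *\<^sub>v v) $ c))\<^sup>2) / real d"
    by (subst sum.swap) (simp add: sum_divide_distrib)
  also have "\<dots> = (\<Sum>c<n. (cmod (v $ c))\<^sup>2)"
    using d by (simp add: unitary_norm[OF K v])
  finally show ?thesis .
qed

text \<open>If \<open>A\<^sup>* A v = z v\<close>, then \<open>z\<close> is the quotient of the squared norms of \<open>A v\<close> and \<open>v\<close>.\<close>
lemma gram_eigenvalue_range:
  assumes K: "\<And>s. s \<in> {1..d} \<Longrightarrow> unitary_mat n (K s)" and d: "d \<ge> 1"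
    and z: "z \<in># proots (char_poly (mat_adjoint (avg_mat n d K) * avg_mat n d K))"
  shows "\<exists>x. z = of_real x \<and> 0 \<le> x \<and> x \<le> 1"
proof -
  define A where "A = avg_mat n d K"
  have A: "A \<in> carrier_mat n n" by (simp add: A_def)
  have B: "mat_adjoint A * A \<in> carrier_mat n n" using A mat_adjoint_carrier[OF A] by simp
  have "poly (char_poly (mat_adjoint A * A)) z = 0"
    using z degree_monic_char_poly[OF B] by (subst (asm) set_count_proots) (auto simp: A_def)
  then have "eigenvalue (mat_adjoint A * A) z"
    using eigenvalue_root_char_poly[OF B] by simp
  then obtain v where v: "v \<in> carrier_vec n" "v \<noteq> 0\<^sub>v n" "(mat_adjoint A * A) *\<^sub>v v = z \<cdot>\<^sub>v v"
    using B unfolding eigenvalue_def eigenvector_def by auto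
  define m where "m = (\<Sum>c<n. (cmod (v $ c))\<^sup>2)"
  define q where "q = (\<Sum>c<n. (cmod ((A *\<^sub>v v) $ c))\<^sup>2)"
  have "m \<noteq> 0"
  proof
    assume "m = 0"
    then have "\<forall>c<n. v $ c = 0" by (simp add: m_def sum_nonneg_eq_0_iff)
    then show False using v(1,2) by (auto intro!: eq_vecI)
  qed
  moreover have "m \<ge> 0" by (auto simp: m_def intro: sum_nonneg)
  ultimately have m: "m > 0" by simp
  have "of_real q = (\<Sum>a<n. cnj (v $ a) * (z * v $ a))"
    using gram_quadratic_form[OF A v(1)] v by (simp add: q_def)
  also have "\<dots> = z * of_real m"
    by (simp add: m_def complex_norm_square sum_distrib_left mult_ac del: of_real_power)
  finally have "z = of_real (q / m)" using m by (simp add: field_simps)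
  moreover have "q \<ge> 0" by (auto simp: q_def intro: sum_nonneg)
  moreover have "q \<le> m" unfolding q_def m_def A_def by (rule avg_unitary_contraction[OF K d v(1)])
  ultimately show ?thesis using m by (intro exI[of _ "q / m"]) auto
qed

section \<open>The second largest element of a multiset\<close>

lemma decreasing_list_Cons_Cons:
  fixes M :: "real multiset"
  assumes "size M \<ge> 2"
  obtains x y ys where "rev (sorted_list_of_multiset M) = x # y # ys" "\<forall>z\<in>set ys. z \<le> y"
    "M = mset (x # y # ys)"
proof -
  define xs where "xs = rev (sorted_list_of_multiset M)"
  have M: "mset xs = M" by (simp add: xs_def)
  have "length xs \<ge> 2" using assms M size_mset[of xs] by simp
  then obtain x y ys where xs: "xs = x # y # ys"
    by (metis Suc_le_length_iff numeral_2_eq_2)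
  have "sorted (rev xs)" by (simp add: xs_def)
  then have "\<forall>z\<in>set ys. z \<le> y" by (auto simp: xs sorted_append)
  then show ?thesis using that xs M xs_def by metis
qed

lemma power_sum_le_second_largest:
  fixes M :: "real multiset"
  assumes "size M \<ge> 2" and M: "\<And>x. x \<in># M \<Longrightarrow> 0 \<le> x \<and> x \<le> 1"
  shows "(\<Sum>x\<in>#M. x ^ k) \<le> 1 + real (size M) * (rev (sorted_list_of_multiset M) ! 1) ^ k"
proof -
  obtain x y ys where xs: "rev (sorted_list_of_multiset M) = x # y # ys" "\<forall>z\<in>set ys. z \<le> y"
    "M = mset (x # y # ys)" by (rule decreasing_list_Cons_Cons[OF assms(1)])
  have x: "x ^ k \<le> 1" using M[of x] xs(3) by (auto intro!: power_le_one)
  have y: "y \<ge> 0" using M[of y] xs(3) by auto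
  have "z ^ k \<le> y ^ k" if "z \<in> set ys" for z
    using that xs M[of z] by (auto intro!: power_mono)
  then have ys: "(\<Sum>z\<leftarrow>ys. z ^ k) \<le> (\<Sum>z\<leftarrow>ys. y ^ k)" by (intro sum_list_mono) auto
  have "(\<Sum>x\<in>#M. x ^ k) = x ^ k + y ^ k + (\<Sum>z\<leftarrow>ys. z ^ k)"
    unfolding xs(3) by (simp flip: sum_mset_sum_list)
  also have "\<dots> \<le> 1 + y ^ k + real (length ys) * y ^ k"
    using x ys by (simp add: sum_list_triv)
  also have "\<dots> \<le> 1 + real (size M) * y ^ k"
    unfolding xs(3) using y by (simp add: algebra_simps)
  finally show ?thesis using xs(1) by simp
qed

lemma second_largest_ge:
  fixes M :: "real multiset"
  assumes "{#a, b#} \<subseteq># M" "a \<ge> c" "b \<ge> c"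
  shows "rev (sorted_list_of_multiset M) ! 1 \<ge> c"
proof (rule ccontr)
  have "size M \<ge> 2" using size_mset_mono[OF assms(1)] by simp
  then obtain x y ys where xs: "rev (sorted_list_of_multiset M) = x # y # ys" "\<forall>z\<in>set ys. z \<le> y"
    "M = mset (x # y # ys)" by (rule decreasing_list_Cons_Cons)
  assume "\<not> rev (sorted_list_of_multiset M) ! 1 \<ge> c"
  then have "y < c" using xs(1) by simp
  then have "filter (\<lambda>z. z \<ge> c) (y # ys) = []"
    using xs(2) by (auto simp: filter_empty_conv)
  moreover have "filter_mset (\<lambda>z. z \<ge> c) M =
      filter_mset (\<lambda>z. z \<ge> c) {#x#} + mset (filter (\<lambda>z. z \<ge> c) (y # ys))"
    unfolding xs(3) by simp
  ultimately have "filter_mset (\<lambda>z. z \<ge> c) M \<subseteq># {#x#}"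
    by (simp del: filter.simps)
  moreover have "{#a, b#} \<subseteq># filter_mset (\<lambda>z. z \<ge> c) M"
    using multiset_filter_mono[OF assms(1), of "\<lambda>z. z \<ge> c"] assms(2,3) by simp
  ultimately have "{#a, b#} \<subseteq># {#x#}" by (rule subset_mset.order_trans[rotated])
  then show False using size_mset_mono by fastforce
qed

section \<open>The trace inequality for the second singular value\<close>

abbreviation expander_gram :: "nat \<Rightarrow> nat \<Rightarrow> (nat \<Rightarrow> complex mat) \<Rightarrow> complex mat" where
  "expander_gram N d U \<equiv>
     mat_adjoint (avg_mat (N * N) d (\<lambda>s. conjugation_mat N (mat_adjoint (U s)))) *
     avg_mat (N * N) d (\<lambda>s. conjugation_mat N (mat_adjoint (U s)))"

lemma expander_gram_carrier: "expander_gram N d U \<in> carrier_mat (N * N) (N * N)"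
  by (intro mult_carrier_mat[of _ _ "N * N"] mat_adjoint_carrier avg_mat_carrier)

lemma singular_value_2_expander:
  assumes U: "\<And>s. s \<in> {1..d} \<Longrightarrow> unitary_mat N (U s)"
  shows "singular_value N 2 (expander_op N d U) = rev (sorted_list_of_multiset
    (image_mset (\<lambda>z. sqrt (Re z)) (proots (char_poly (expander_gram N d U))))) ! 1"
  using operator_mat_expander_gram[of d U N] U
  by (simp add: singular_value_def singular_values_def operator_eigenvalues_def unitary_mat_def)

lemma unitary_conjugation_mat_adjoint:
  assumes "unitary_mat N V"
  shows "unitary_mat (N * N) (conjugation_mat N (mat_adjoint V))"
  by (intro unitary_conjugation_mat unitary_mat_adjoint assms)

lemma alternating_word_conjugation:
  assumes U: "\<And>s. s \<in> {1..d} \<Longrightarrow> unitary_mat N (U s)" and r: "set r \<subseteq> {1..d}"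
  shows "\<exists>W \<in> carrier_mat N N.
    alternating_word (N * N) (\<lambda>s. conjugation_mat N (U s)) b r = conjugation_mat N W"
  using r
proof (induction r arbitrary: b)
  case Nil
  show ?case by (intro bexI[of _ "1\<^sub>m N"]) (auto simp: conjugation_mat_one)
next
  case (Cons s r)
  then obtain W where W: "W \<in> carrier_mat N N"
    "alternating_word (N * N) (\<lambda>s. conjugation_mat N (U s)) (\<not> b) r = conjugation_mat N W"
    by auto
  define V where "V = (if b then U s else mat_adjoint (U s))"
  have Us: "U s \<in> carrier_mat N N" using U Cons.prems by (simp add: unitary_mat_def)
  then have V: "V \<in> carrier_mat N N" by (simp add: V_def mat_adjoint_carrier)
  have "letter (\<lambda>s. conjugation_mat N (U s)) b s = conjugation_mat N V"
    by (simp add: letter_def V_def conjugation_mat_adjoint[OF Us])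
  then show ?case using W V by (intro bexI[of _ "V * W"]) (auto simp: conjugation_mat_mult)
qed

text \<open>Both sides estimate \<open>Tr (A\<^sup>* A)^p\<close>: from below by walks on the tree, from above by
  the sum of the powers of the singular values, of which the largest is at most 1 and each
  of the others at most \<open>s2\<close>. The words have nonnegative trace because words in conjugations are conjugations.\<close>
lemma second_singular_value_power_bound:
  assumes U: "\<And>s. s \<in> {1..d} \<Longrightarrow> unitary_mat N (U s)" and d: "d \<ge> 1" and N: "N \<ge> 2"
  defines "s2 \<equiv> singular_value N 2 (expander_op N d U)"
  shows "real N ^ 2 * (ballot (2 * p) p * (real d - 1) ^ p / real d ^ (2 * p)) \<le>
    1 + real N ^ 2 * s2 ^ (2 * p)"
proof -
  define K where "K = (\<lambda>s. conjugation_mat N (mat_adjoint (U s)))"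
  have K: "unitary_mat (N * N) (K s)" if "s \<in> {1..d}" for s
    unfolding K_def by (rule unitary_conjugation_mat_adjoint[OF U[OF that]])
  define B where "B = mat_adjoint (avg_mat (N * N) d K) * avg_mat (N * N) d K"
  have BU: "expander_gram N d U = B" by (simp add: B_def K_def)
  have B: "B \<in> carrier_mat (N * N) (N * N)" using expander_gram_carrier[of N d U] BU by simp
  define Z where "Z = proots (char_poly B)"
  define M where "M = image_mset (\<lambda>z. sqrt (Re z)) Z"
  have Z: "\<exists>x. z = of_real x \<and> 0 \<le> x \<and> x \<le> 1" if "z \<in># Z" for z
    using gram_eigenvalue_range[of d "N * N" K z] K d that unfolding Z_def B_def by blast
  have size: "size M = N * N" by (simp add: M_def Z_def size_proots_char_poly[OF B])
  have "N * N \<ge> 2 * 1" using N by (intro mult_mono) auto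
  then have size2: "size M \<ge> 2" using size by simp
  have M: "0 \<le> x \<and> x \<le> 1" if "x \<in># M" for x
    using that Z by (fastforce simp: M_def)
  have s2: "s2 = rev (sorted_list_of_multiset M) ! 1"
    unfolding s2_def M_def Z_def BU[symmetric] by (rule singular_value_2_expander) (rule U)
  have words: "0 \<le> Re (trace_mat (alternating_word (N * N) K b r))" if "set r \<subseteq> {1..d}" for b r
    using alternating_word_conjugation[OF unitary_mat_adjoint[OF U] that, of "\<lambda>s. s" b]
      trace_conjugation_mat unfolding K_def by fastforce
  have "real (N * N) * ballot (2 * p) p * (real d - 1) ^ p / real d ^ (2 * p) \<le>
      Re (trace_mat (B ^\<^sub>m p))"
    unfolding B_def by (rule trace_gram_power_lower_bound[OF K words d])
  also have "\<dots> = (\<Sum>z\<in>#Z. Re (z ^ p))"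
    using Re_sum_mset[of "\<lambda>z. z ^ p" Z] by (simp add: trace_power_eq_sum_eigenvalues[OF B] Z_def)
  also have "\<dots> = (\<Sum>z\<in>#Z. sqrt (Re z) ^ (2 * p))"
    using Z by (intro arg_cong[of _ _ sum_mset] image_mset_cong) (force simp: power_mult)
  also have "\<dots> = (\<Sum>x\<in>#M. x ^ (2 * p))" by (simp add: M_def image_mset.compositionality comp_def)
  also have "\<dots> \<le> 1 + real (size M) * s2 ^ (2 * p)"
    unfolding s2 by (rule power_sum_le_second_largest[OF size2 M])
  finally show ?thesis by (simp add: size power2_eq_square)
qed

text \<open>Being chosen from a list by position, the second singular value is known to be nonnegative only once
  the list is known to have at least two entries.\<close>
lemma second_singular_value_nonneg:
  assumes U: "\<And>s. s \<in> {1..d} \<Longrightarrow> unitary_mat N (U s)" and d: "d \<ge> 1" and N: "N \<ge> 2"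
  shows "0 \<le> singular_value N 2 (expander_op N d U)"
proof -
  define Z where "Z = proots (char_poly (expander_gram N d U))"
  have "\<exists>x. z = of_real x \<and> 0 \<le> x \<and> x \<le> 1" if "z \<in># Z" for z
    using gram_eigenvalue_range[OF unitary_conjugation_mat_adjoint[OF U] d that[unfolded Z_def]] by simp
  then have nonneg: "x \<ge> 0" if "x \<in># image_mset (\<lambda>z. sqrt (Re z)) Z" for x using that by fastforce
  have "size (image_mset (\<lambda>z. sqrt (Re z)) Z) = N * N"
    by (simp add: Z_def size_proots_char_poly[OF expander_gram_carrier])
  moreover have "N * N \<ge> 2 * 1" using N by (intro mult_mono) auto
  ultimately have "size (image_mset (\<lambda>z. sqrt (Re z)) Z) \<ge> 2" by simp
  then obtain x y ys where xs: "rev (sorted_list_of_multiset (image_mset (\<lambda>z. sqrt (Re z)) Z)) = x # y # ys"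
    "\<forall>z\<in>set ys. z \<le> y" "image_mset (\<lambda>z. sqrt (Re z)) Z = mset (x # y # ys)"
    by (rule decreasing_list_Cons_Cons)
  then have "y \<ge> 0" by (intro nonneg) simp
  then show ?thesis
    using xs(1) unfolding Z_def by (subst singular_value_2_expander[OF U]) simp_all
qed

section \<open>Two unitary matrices\<close>

lemma upper_triangular_left_inverse:
  fixes S T :: "complex mat"
  assumes S: "S \<in> carrier_mat n n" and T: "T \<in> carrier_mat n n" "upper_triangular T" and ST: "S * T = 1\<^sub>m n"
  shows "upper_triangular S \<and> (\<forall>j<n. S $$ (j, j) * T $$ (j, j) = 1)"
proof -
  have "\<forall>i<n. j \<le> i \<longrightarrow> S $$ (i, j) * T $$ (j, j) = (if i = j then 1 else 0)" if "j < n" for j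
    using that
  proof (induction j rule: less_induct)
    case (less j)
    have zero: "S $$ (i, k) = 0" if "k < j" "j \<le> i" "i < n" for i k
    proof -
      have "S $$ (k, k) * T $$ (k, k) = 1" and "S $$ (i, k) * T $$ (k, k) = 0"
        using less.IH[of k] less.prems that by auto
      then show ?thesis by auto
    qed
    show ?case
    proof (intro allI impI)
      fix i assume i: "i < n" "j \<le> i"
      have "(if i = j then 1 else 0) = (S * T) $$ (i, j)" using ST i less.prems by simp
      also have "\<dots> = (\<Sum>k<n. S $$ (i, k) * T $$ (k, j))"
        using i less.prems by (intro index_mult_mat_sum[OF S T(1)]) auto
      also have "\<dots> = (\<Sum>k<n. if k = j then S $$ (i, j) * T $$ (j, j) else 0)"
      proof (intro sum.cong refl)
        fix k assume k: "k \<in> {..<n}"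
        consider "k < j" | "k = j" | "k > j" by linarith
        then show "S $$ (i, k) * T $$ (k, j) = (if k = j then S $$ (i, j) * T $$ (j, j) else 0)"
          by cases (use zero i k T in \<open>auto simp: upper_triangularD\<close>)
      qed
      finally show "S $$ (i, j) * T $$ (j, j) = (if i = j then 1 else 0)" using less.prems by simp
    qed
  qed
  note * = this
  have "S $$ (i, j) = 0" if "j < i" "i < n" for i j
  proof -
    have "S $$ (j, j) * T $$ (j, j) = 1" "S $$ (i, j) * T $$ (j, j) = 0" using *[of j] that by auto
    then show ?thesis by auto
  qed
  then show ?thesis using * S by auto
qed

text \<open>The coding of index pairs is lexicographic, hence refines the componentwise order.\<close>
lemma upper_triangular_conjugation_mat:
  assumes T: "T \<in> carrier_mat N N" "upper_triangular T"
  shows "upper_triangular (conjugation_mat N T)"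
proof (rule upper_triangularI)
  fix a b assume ba: "b < a" and "a < dim_row (conjugation_mat N T)"
  then have ab: "a < N * N" "b < N * N" by (auto simp: conjugation_mat_def)
  note bd = div_mod_bounds[OF ab(1)] div_mod_bounds[OF ab(2)]
  have "b div N < a div N \<or> b mod N < a mod N"
  proof (rule ccontr)
    assume *: "\<not> ?thesis"
    have "a div N \<le> b div N" "a mod N \<le> b mod N" using * by auto
    then have "N * (a div N) + a mod N \<le> N * (b div N) + b mod N" by (intro add_mono mult_left_mono) auto
    then show False using ba by simp
  qed
  then show "conjugation_mat N T $$ (a, b) = 0"
    using ab bd upper_triangularD[OF T(2)] T(1) by (auto simp: conjugation_mat_def)
qed

lemma pair_subseteq_mset:
  assumes "i < j" "j < length xs"
  shows "{#xs ! i, xs ! j#} \<subseteq># mset xs"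
proof -
  have "mset_set {i, j} \<subseteq># mset_set {..<length xs}"
    using assms by (intro subset_imp_msubset_mset_set) auto
  then have "image_mset ((!) xs) (mset_set {i, j}) \<subseteq># image_mset ((!) xs) (mset_set {..<length xs})"
    by (rule image_mset_subseteq_mono)
  also have "image_mset ((!) xs) (mset_set {..<length xs}) = mset xs"
    by (metis map_nth mset_map mset_upt lessThan_atLeast0)
  finally show ?thesis using assms by simp
qed

lemma expander_gram_two:
  assumes U: "\<And>s. s \<in> {1..2} \<Longrightarrow> unitary_mat N (U s)"
  shows "expander_gram N 2 U = (1 / 4) \<cdot>\<^sub>m (2 \<cdot>\<^sub>m 1\<^sub>m (N * N) +
    (conjugation_mat N (U 1 * mat_adjoint (U 2)) + conjugation_mat N (U 2 * mat_adjoint (U 1))))"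
proof -
  define n where "n = N * N"
  define K where "K = (\<lambda>s. conjugation_mat N (mat_adjoint (U s)))"
  have u: "U s \<in> carrier_mat N N" "U s * mat_adjoint (U s) = 1\<^sub>m N"
    "mat_adjoint (U s) \<in> carrier_mat N N" if "s \<in> {1..2}" for s
    using U[OF that] mat_adjoint_carrier by (auto simp: unitary_mat_def)
  have K: "K s \<in> carrier_mat n n" "mat_adjoint (K s) \<in> carrier_mat n n" for s
    by (auto simp: K_def n_def intro: mat_adjoint_carrier)
  have K': "mat_adjoint (K s) = conjugation_mat N (U s)" if "s \<in> {1..2}" for s
    using u[OF that] by (simp add: K_def conjugation_mat_adjoint mat_adjoint_adjoint[of _ N N])
  have KK: "mat_adjoint (K s) * K t = conjugation_mat N (U s * mat_adjoint (U t))"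
    if "s \<in> {1..2}" "t \<in> {1..2}" for s t
    using K'[OF that(1)] u[OF that(1)] u[OF that(2)] by (simp add: K_def conjugation_mat_mult)
  have avg2: "avg_mat n 2 L = (1 / 2) \<cdot>\<^sub>m (L 1 + L 2)"
    if "\<And>s. L s \<in> carrier_mat n n" for L :: "nat \<Rightarrow> complex mat"
  proof (rule eq_matI)
    fix i j assume "i < dim_row ((1 / 2) \<cdot>\<^sub>m (L 1 + L 2))" "j < dim_col ((1 / 2) \<cdot>\<^sub>m (L 1 + L 2))"
    then have "i < n" "j < n" using that[of 2] by auto
    then show "avg_mat n 2 L $$ (i, j) = ((1 / 2) \<cdot>\<^sub>m (L 1 + L 2)) $$ (i, j)"
      using that[of 1] that[of 2] by (simp add: avg_mat_def numeral_2_eq_2)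
  qed (use that[of 2] in \<open>auto simp: avg_mat_def\<close>)
  have halves: "(1 / 2 :: complex) \<cdot>\<^sub>m ((1 / 2) \<cdot>\<^sub>m X) = (1 / 4) \<cdot>\<^sub>m X" for X
    by (intro eq_matI) auto
  have "expander_gram N 2 U = avg_mat n 2 (\<lambda>s. mat_adjoint (K s)) * avg_mat n 2 K"
    using mat_adjoint_avg_mat[of 2 K n] K by (simp add: K_def n_def)
  also have "\<dots> = ((1 / 2) \<cdot>\<^sub>m (mat_adjoint (K 1) + mat_adjoint (K 2))) * ((1 / 2) \<cdot>\<^sub>m (K 1 + K 2))"
    using avg2[of K] avg2[of "\<lambda>s. mat_adjoint (K s)"] K by simp
  also have "\<dots> = (1 / 4) \<cdot>\<^sub>m ((mat_adjoint (K 1) + mat_adjoint (K 2)) * (K 1 + K 2))"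
    using K[of 1] K[of 2] by (simp add: mult_smult_assoc_mat[of _ n n _ n] mult_smult_distrib[of _ n n _ n]
        halves)
  also have "(mat_adjoint (K 1) + mat_adjoint (K 2)) * (K 1 + K 2) =
      (mat_adjoint (K 1) * K 1 + mat_adjoint (K 2) * K 1) + (mat_adjoint (K 1) * K 2 + mat_adjoint (K 2) * K 2)"
    using K[of 1] K[of 2]
    by (simp add: add_mult_distrib_mat[of _ n n _ _ n] mult_add_distrib_mat[of _ n n _ n])
  also have "\<dots> = 2 \<cdot>\<^sub>m 1\<^sub>m n + (conjugation_mat N (U 1 * mat_adjoint (U 2)) +
      conjugation_mat N (U 2 * mat_adjoint (U 1)))"
    using u by (intro eq_matI) (auto simp: KK conjugation_mat_one n_def)
  finally show ?thesis by (simp add: n_def)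
qed

text \<open>The Schur form \<open>V = P T Q\<close> is used with \<open>Q\<close> the inverse, not the adjoint, of \<open>P\<close>; conjugation by \<open>\<phi>(P)\<close>
  then turns \<open>\<phi>(V)\<close> and \<open>\<phi>(V^(-1))\<close> into the triangular matrices \<open>\<phi>(T)\<close> and \<open>\<phi>(T^(-1))\<close>. At the index
  of \<open>(i, i)\<close> their diagonal entries are \<open>x = \<bar>T\<^sub>i\<^sub>i\<bar>^2\<close> and \<open>1 / x\<close>, with sum at least 2 whatever \<open>x\<close> is.\<close>
lemma second_singular_value_two:
  assumes U: "\<And>s. s \<in> {1..2} \<Longrightarrow> unitary_mat N (U s)" and N: "N \<ge> 2"
  shows "singular_value N 2 (expander_op N 2 U) \<ge> 1"
proof -
  define n where "n = N * N"
  define V where "V = U 1 * mat_adjoint (U 2)"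
  define V' where "V' = U 2 * mat_adjoint (U 1)"
  have u: "U s \<in> carrier_mat N N" "mat_adjoint (U s) * U s = 1\<^sub>m N" "U s * mat_adjoint (U s) = 1\<^sub>m N"
    "mat_adjoint (U s) \<in> carrier_mat N N" if "s \<in> {1..2}" for s
    using U[OF that] mat_adjoint_carrier by (auto simp: unitary_mat_def)
  note u1 = u[of 1, simplified] note u2 = u[of 2, simplified]
  have V: "V \<in> carrier_mat N N" "V' \<in> carrier_mat N N" using u1 u2 by (auto simp: V_def V'_def)
  have "V' * V = U 2 * (mat_adjoint (U 1) * U 1) * mat_adjoint (U 2)"
    unfolding V_def V'_def using u1(1,4) u2(1,4) by (simp add: assoc_mult_mat[of _ N N _ N _ N])
  then have VV: "V' * V = 1\<^sub>m N" using u1 u2 by simp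
  obtain es where es: "char_poly V = (\<Prod>a\<leftarrow>es. [:- a, 1:])"
    using char_poly_factorized[OF V(1)] by blast
  obtain T P Q where "schur_decomposition V es = (T, P, Q)"
    by (cases "schur_decomposition V es")
  from schur_decomposition[OF V(1) es this]
  have sim: "similar_mat_wit V T P Q" and Tu: "upper_triangular T" by auto
  note wit = similar_mat_witD2[OF V(1) sim]
  note wit' = similar_mat_witD2(3)[OF wit(5) similar_mat_wit_sym[OF sim]]
  define S where "S = Q * V' * P"
  have S: "S \<in> carrier_mat N N" using wit V by (simp add: S_def)
  have "S * T = Q * V' * (P * Q) * V * P"
    unfolding S_def wit' using wit(5-7) V by (simp add: assoc_mult_mat[of _ N N _ N _ N])
  also have "\<dots> = Q * (V' * V) * P"
    unfolding wit(1) using wit(6,7) V by (simp add: assoc_mult_mat[of _ N N _ N _ N])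
  also have "\<dots> = 1\<^sub>m N" unfolding VV using wit by simp
  finally have ST: "S * T = 1\<^sub>m N" .
  have Su: "upper_triangular S" and inv: "\<And>j. j < N \<Longrightarrow> S $$ (j, j) * T $$ (j, j) = 1"
    using upper_triangular_left_inverse[OF S wit(5) Tu ST] by auto
  let ?phi = "conjugation_mat N"
  define R where "R = (1 / 4) \<cdot>\<^sub>m (2 \<cdot>\<^sub>m 1\<^sub>m n + (?phi T + ?phi S))"
  define B where "B = expander_gram N 2 U"
  have phi: "?phi W \<in> carrier_mat n n" for W by (simp add: n_def)
  have B: "B = (1 / 4) \<cdot>\<^sub>m (2 \<cdot>\<^sub>m 1\<^sub>m n + (?phi V + ?phi V'))"
    unfolding B_def V_def V'_def n_def by (rule expander_gram_two[OF U])
  have Bc: "B \<in> carrier_mat n n" and Rc: "R \<in> carrier_mat n n" using phi by (auto simp: B R_def)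
  have QVP: "?phi Q * ?phi V * ?phi P = ?phi T" "?phi Q * ?phi V' * ?phi P = ?phi S" "?phi Q * ?phi P = 1\<^sub>m n"
    "?phi P * ?phi Q = 1\<^sub>m n"
    using wit V wit' by (auto simp: conjugation_mat_mult S_def conjugation_mat_one n_def)
  have "?phi Q * B = (1 / 4) \<cdot>\<^sub>m (2 \<cdot>\<^sub>m ?phi Q + (?phi Q * ?phi V + ?phi Q * ?phi V'))"
    unfolding B using phi
    by (simp add: mult_smult_distrib[of _ n n _ n] mult_add_distrib_mat[of _ n n _ n]
        right_mult_one_mat[OF phi])
  also have "\<dots> * ?phi P = R"
    unfolding R_def QVP(1,2,3)[symmetric] using phi
    by (simp add: mult_smult_assoc_mat[of _ n n _ n] add_mult_distrib_mat[of _ n n _ _ n]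
        mult_carrier_mat[of _ n n _ n])
  finally have R: "R = ?phi Q * B * ?phi P" ..
  have "similar_mat_wit R B (?phi Q) (?phi P)"
    using QVP R phi Bc Rc by (intro similar_mat_witI[of _ _ n]) auto
  then have "similar_mat R B" unfolding similar_mat_def by blast
  then have "char_poly B = char_poly R" by (rule char_poly_similar[symmetric])
  also have "\<dots> = (\<Prod>a\<leftarrow>diag_mat R. [:- a, 1:])"
  proof (rule char_poly_upper_triangular[OF Rc])
    show "upper_triangular R"
    proof (rule upper_triangularI)
      fix a b assume ba: "b < a" and "a < dim_row R"
      then have ab: "a < n" "b < n" using Rc by auto
      have "?phi T $$ (a, b) = 0" "?phi S $$ (a, b) = 0"
        using upper_triangularD[OF upper_triangular_conjugation_mat[OF wit(5) Tu] ba]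
          upper_triangularD[OF upper_triangular_conjugation_mat[OF S Su] ba] ab by (auto simp: n_def)
      then show "R $$ (a, b) = 0" using ba ab by (simp add: R_def n_def)
    qed
  qed
  finally have eig: "proots (char_poly B) = mset (diag_mat R)" by (simp add: proots_linear_factors)
  have diag: "sqrt (Re (diag_mat R ! (i * N + i))) \<ge> 1" and len: "i * N + i < length (diag_mat R)"
    if i: "i < N" for i
  proof -
    have "i * N + i < Suc i * N" using i by simp
    also have "\<dots> \<le> n" unfolding n_def using i by (intro mult_right_mono) auto
    finally have a: "i * N + i < n" .
    then show "i * N + i < length (diag_mat R)" using Rc by (simp add: diag_mat_def)
    define x where "x = (cmod (T $$ (i, i)))\<^sup>2"
    define y where "y = (cmod (S $$ (i, i)))\<^sup>2"
    have "cmod (S $$ (i, i)) * cmod (T $$ (i, i)) = 1" using inv[OF i] by (metis norm_mult norm_one)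
    then have xy: "y * x = 1" unfolding x_def y_def by (metis power_mult_distrib power_one)
    have "diag_mat R ! (i * N + i) = of_real ((2 + (x + y)) / 4)"
      using a Rc i phi unfolding x_def y_def of_real_add of_real_divide complex_norm_square
      by (simp add: diag_mat_def R_def conjugation_mat_def n_def)
    moreover have "x + y \<ge> 2"
    proof -
      have "0 \<le> (cmod (T $$ (i, i)) - cmod (S $$ (i, i)))\<^sup>2" by simp
      then show ?thesis
        using \<open>cmod (S $$ (i, i)) * cmod (T $$ (i, i)) = 1\<close>
        by (simp add: x_def y_def power2_eq_square algebra_simps)
    qed
    ultimately show "sqrt (Re (diag_mat R ! (i * N + i))) \<ge> 1"
      by (simp only: Re_complex_of_real real_sqrt_ge_1_iff) simp
  qed
  have "{#diag_mat R ! (0 * N + 0), diag_mat R ! (1 * N + 1)#} \<subseteq># proots (char_poly B)"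
    unfolding eig using N len[of 1] by (intro pair_subseteq_mset) auto
  then have "{#sqrt (Re (diag_mat R ! (0 * N + 0))), sqrt (Re (diag_mat R ! (1 * N + 1)))#} \<subseteq>#
      image_mset (\<lambda>z. sqrt (Re z)) (proots (char_poly B))"
    using image_mset_subseteq_mono by fastforce
  then have "rev (sorted_list_of_multiset (image_mset (\<lambda>z. sqrt (Re z)) (proots (char_poly B)))) ! 1 \<ge> 1"
    by (rule second_largest_ge) (use diag[of 0] diag[of 1] N in auto)
  then show ?thesis
    using singular_value_2_expander[of 2 N U, OF U] by (simp add: B_def)
qed

section \<open>Choice of the exponent and conclusion\<close>

lemma sigma_deg_square:
  assumes "d \<ge> 1"
  shows "(sigma_deg d)\<^sup>2 = 4 * (real d - 1) / (real d)\<^sup>2"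
  using assms by (simp add: sigma_deg_def power_divide power_mult_distrib)

lemma sigma_deg_nonneg: "d \<ge> 1 \<Longrightarrow> sigma_deg d \<ge> 0"
  by (simp add: sigma_deg_def)

lemma sigma_deg_power:
  assumes "d \<ge> 1"
  shows "sigma_deg d ^ (2 * p) = 4 ^ p * (real d - 1) ^ p / real d ^ (2 * p)"
  by (simp only: power_mult sigma_deg_square[OF assms] power_divide power_mult_distrib)

text \<open>With \<open>q = 2 ln (1 / \<sigma>)\<close> the exponent is the integer part of \<open>ln N / q\<close>. The upper bound
  on it is uniform in \<open>d\<close> because \<open>\<sigma>\<^sup>2 \<le> 8 / 9\<close> for \<open>d \<ge> 3\<close>, with equality at \<open>d = 3\<close>. The exponent is at least 1
  because \<open>\<sigma>\<^sup>2 \<ge> 1 / d \<ge> 1 / N\<close>.\<close>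
lemma p_exp_bounds:
  assumes d: "d \<ge> 3" and dN: "d \<le> N"
  obtains p where "p \<ge> 1" "p_exp N d = int p" "real p \<le> 1 / ln (9 / 8) * ln (real N)"
    "1 / real N \<le> sigma_deg d ^ (2 * p)" "sigma_deg d \<le> 1"
proof -
  define q where "q = 2 * ln (1 / sigma_deg d)"
  have rd: "real d \<ge> 3" using d by simp
  have s0: "sigma_deg d > 0" using rd by (simp add: sigma_deg_def)
  have s2: "(sigma_deg d)\<^sup>2 = 4 * (real d - 1) / (real d)\<^sup>2" using d by (intro sigma_deg_square) auto
  \<comment> \<open>Multiplied by 4, this is \<open>36 * (d - 1) \<le> 8 * d\<^sup>2\<close>.\<close>
  have "(2 * real d - 3) * (real d - 3) \<ge> 0" using rd by (intro mult_nonneg_nonneg) auto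
  then have "(sigma_deg d)\<^sup>2 \<le> 8 / 9"
    unfolding s2 using rd by (simp add: divide_le_eq power2_eq_square algebra_simps)
  moreover have "1 / real d \<le> (sigma_deg d)\<^sup>2"
    unfolding s2 using rd by (simp add: field_simps power2_eq_square)
  moreover have q: "q = - ln ((sigma_deg d)\<^sup>2)"
    using s0 by (simp add: q_def ln_div ln_realpow)
  ultimately have "- ln (8 / 9) \<le> q" "q \<le> - ln (1 / real d)"
    using s0 rd by auto
  moreover have "ln (real d) \<le> ln (real N)" using rd dN by simp
  ultimately have q1: "ln (9 / 8) \<le> q" and q2: "q \<le> ln (real N)"
    using rd by (auto simp: ln_div)
  have q0: "0 < ln (9 / 8 :: real)" by simp
  then have qpos: "q > 0" using q1 by linarith
  have quot: "1 \<le> ln (real N) / q" using q2 qpos by simp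
  define p where "p = nat \<lfloor>ln (real N) / q\<rfloor>"
  have pe: "p_exp N d = int p"
    using quot by (simp add: p_def p_exp_def q_def le_floor_iff order_trans[OF _ quot])
  have p1: "p \<ge> 1" using quot by (simp add: p_def le_nat_iff le_floor_iff)
  have pq: "real p \<le> ln (real N) / q"
    using quot by (simp add: p_def of_nat_nat)
  also have "\<dots> \<le> ln (real N) / ln (9 / 8)"
    using q0 q1 q2 qpos by (intro divide_left_mono) auto
  finally have pk: "real p \<le> 1 / ln (9 / 8) * ln (real N)" by simp
  have N: "real N > 0" using dN d by simp
  have "(sigma_deg d)\<^sup>2 = exp (- q)" using q s0 by simp
  then have "sigma_deg d ^ (2 * p) = exp (- (real p * q))"
    by (simp add: power_mult exp_of_nat_mult[symmetric])
  moreover have "real p * q \<le> ln (real N)" using pq qpos by (simp add: field_simps)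
  then have "exp (- ln (real N)) \<le> exp (- (real p * q))" by simp
  ultimately have sp: "1 / real N \<le> sigma_deg d ^ (2 * p)"
    using N by (simp add: exp_minus inverse_eq_divide)
  have "(sigma_deg d)\<^sup>2 \<le> 1\<^sup>2" using \<open>(sigma_deg d)\<^sup>2 \<le> 8 / 9\<close> by simp
  then have "sigma_deg d \<le> 1" by (rule power2_le_imp_le) simp
  then show ?thesis using that p1 pe pk sp by blast
qed

lemma mult_root_le:
  fixes s t x :: real
  assumes "s \<ge> 0" "x \<ge> 0" "k \<ge> 1" "t ^ k * x \<le> s ^ k"
  shows "t * x powr (1 / real k) \<le> s"
proof (rule power_le_imp_le_base[of _ "k - 1"])
  have "(x powr (1 / real k)) ^ k = x"
    using assms by (cases "x = 0") (auto simp: powr_power)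
  then show "(t * x powr (1 / real k)) ^ Suc (k - 1) \<le> s ^ Suc (k - 1)"
    using assms by (simp add: power_mult_distrib)
qed fact

lemma powr_quarter_bound:
  assumes "real d \<le> real N powr (1 / 4)" "N \<ge> 1"
  shows "d \<le> N"
proof -
  have "real N powr (1 / 4) \<le> real N powr 1" using assms(2) by (intro powr_mono) auto
  then show ?thesis using assms by simp
qed

lemma second_singular_value_walk_bound:
  assumes U: "\<And>s. s \<in> {1..d} \<Longrightarrow> unitary_mat N (U s)" and d: "d \<ge> 1" and N: "N \<ge> 2" and p: "p \<ge> 1"
  shows "sigma_deg d ^ (2 * p) / (4 * real p powr (3 / 2)) - 1 / (real N)\<^sup>2 \<le>
    singular_value N 2 (expander_op N d U) ^ (2 * p)"
proof -
  define X where "X = ballot (2 * p) p * (real d - 1) ^ p / real d ^ (2 * p)"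
  have p0: "real p powr (3 / 2) > 0" using p by simp
  have "sigma_deg d ^ (2 * p) = 4 ^ p * ((real d - 1) ^ p / real d ^ (2 * p))"
    using sigma_deg_power[OF d] by simp
  also have "\<dots> \<le> 4 * real p powr (3 / 2) * ballot (2 * p) p * ((real d - 1) ^ p / real d ^ (2 * p))"
    using d by (intro mult_right_mono ballot_central_bound p) auto
  also have "\<dots> = 4 * real p powr (3 / 2) * X" by (simp add: X_def)
  finally have "sigma_deg d ^ (2 * p) / (4 * real p powr (3 / 2)) \<le> X"
    using p0 by (simp add: divide_le_eq mult.commute)
  moreover have "X - 1 / (real N)\<^sup>2 \<le> singular_value N 2 (expander_op N d U) ^ (2 * p)"
    using second_singular_value_power_bound[of d N U p, OF U d N] N unfolding X_def[symmetric]
    by (simp add: field_simps)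
  ultimately show ?thesis by linarith
qed

theorem lemma1p5:
  shows "\<exists>c::real. c > 0 \<and>
    (\<forall>N::nat. N \<ge> 2 \<longrightarrow>
      (\<forall>d::nat. 2 \<le> d \<and> real d \<le> real N powr (1 / 4) \<longrightarrow>
        (\<forall>U :: nat \<Rightarrow> complex mat. (\<forall>s \<in> {1..d}. unitary_mat N (U s)) \<longrightarrow>
          singular_value N 2 (expander_op N d U)
            \<ge> sigma_deg d *
              (c / ln (real N) powr (3 / 2)) powr (1 / (2 * real_of_int (p_exp N d))))))"
proof -
  define k :: real where "k = 1 / ln (9 / 8)"
  have k: "k > 0" by (simp add: k_def)
  have "eventually (\<lambda>N::nat. 8 * (k * ln (real N)) powr (3 / 2) \<le> real N) at_top"
    using k by real_asymp
  then obtain N0 where N0: "\<And>N. N \<ge> N0 \<Longrightarrow> 8 * (k * ln (real N)) powr (3 / 2) \<le> real N"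
    unfolding eventually_at_top_linorder by blast
  \<comment> \<open>For \<open>N \<ge> N0\<close> the first entry of the minimum is small enough. For \<open>N < N0\<close> we have \<open>N \<le> M\<close>, the
    exponent is at most \<open>P\<close>, and \<open>s\<^sub>2 \<ge> 1 / N \<ge> 1 / M\<close>, so the second entry is.\<close>
  define M where "M = real (max N0 1)"
  have M: "M \<ge> 1" by (simp add: M_def)
  define P where "P = nat \<lceil>k * ln M\<rceil>"
  define c where "c = min (1 / (8 * k powr (3 / 2))) ((1 / M) ^ (2 * P))"
  have c: "c > 0" using k M by (simp add: c_def)
  have "sigma_deg d * (c / ln (real N) powr (3 / 2)) powr (1 / (2 * real_of_int (p_exp N d))) \<le>
      singular_value N 2 (expander_op N d U)"
    if N: "N \<ge> 2" and d2: "2 \<le> d" and dN: "real d \<le> real N powr (1 / 4)"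
      and U: "\<forall>s \<in> {1..d}. unitary_mat N (U s)" for N d and U :: "nat \<Rightarrow> complex mat"
  proof (cases "d = 2")
    case True
    \<comment> \<open>The exponent is \<open>1 / 0 = 0\<close>, so the power is 1, as its base is not 0.\<close>
    have "ln (real N) powr (3 / 2) \<noteq> 0" using N by simp
    moreover have "p_exp N 2 = 0" by (simp add: p_exp_def sigma_deg_def)
    ultimately show ?thesis
      using second_singular_value_two[of N U] U N c True by (simp add: sigma_deg_def)
  next
    case False
    define s where "s = singular_value N 2 (expander_op N d U)"
    have d: "d \<ge> 3" using d2 False by simp
    have dN': "d \<le> N" by (rule powr_quarter_bound[OF dN]) (use N in simp)
    have U': "\<And>s. s \<in> {1..d} \<Longrightarrow> unitary_mat N (U s)" using U by blast
    have s0: "s \<ge> 0" unfolding s_def by (rule second_singular_value_nonneg[OF U']) (use d N in auto)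
    obtain p where p: "p \<ge> 1" "p_exp N d = int p" "real p \<le> k * ln (real N)"
      "1 / real N \<le> sigma_deg d ^ (2 * p)" "sigma_deg d \<le> 1"
      using p_exp_bounds[OF d dN'] unfolding k_def by metis
    have walk: "sigma_deg d ^ (2 * p) / (4 * real p powr (3 / 2)) - 1 / (real N)\<^sup>2 \<le> s ^ (2 * p)"
      unfolding s_def by (rule second_singular_value_walk_bound[OF U']) (use d N p(1) in auto)
    have sig: "sigma_deg d \<ge> 0" using d by (intro sigma_deg_nonneg) simp
    have "1 \<le> ln (real N)"
      using d dN' exp_le ln_mono[of "exp 1" "real N"] by simp
    then have L: "1 \<le> ln (real N) powr (3 / 2)" by (simp add: ge_one_powr_ge_zero)
    have "sigma_deg d ^ (2 * p) * (c / ln (real N) powr (3 / 2)) \<le> s ^ (2 * p)"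
    proof (cases "N \<ge> N0")
      case True
      define G where "G = (k * ln (real N)) powr (3 / 2)"
      have G: "G = k powr (3 / 2) * ln (real N) powr (3 / 2)"
        using k \<open>1 \<le> ln (real N)\<close> by (simp add: G_def powr_mult)
      have G0: "G > 0" unfolding G using k L by (intro mult_pos_pos) (simp, linarith)
      have pG: "real p powr (3 / 2) \<le> G" unfolding G_def using p by (intro powr_mono2) auto
      have GN: "8 * G \<le> real N" unfolding G_def by (rule N0[OF True])
      have "c / ln (real N) powr (3 / 2) \<le> 1 / (8 * k powr (3 / 2)) / ln (real N) powr (3 / 2)"
        using L by (intro divide_right_mono) (auto simp: c_def)
      also have "\<dots> = 1 / (8 * G)" by (simp add: G)
      finally have "sigma_deg d ^ (2 * p) * (c / ln (real N) powr (3 / 2)) \<le>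
          sigma_deg d ^ (2 * p) * (1 / (8 * G))"
        using sig by (intro mult_left_mono) auto
      also have "\<dots> = sigma_deg d ^ (2 * p) / (4 * G) - sigma_deg d ^ (2 * p) * (1 / (8 * G))"
        by (simp add: field_simps)
      also have "\<dots> \<le> sigma_deg d ^ (2 * p) / (4 * real p powr (3 / 2)) - 1 / (real N)\<^sup>2"
      proof (rule diff_mono)
        show "sigma_deg d ^ (2 * p) / (4 * G) \<le> sigma_deg d ^ (2 * p) / (4 * real p powr (3 / 2))"
          using pG p(1) G0 sig by (intro divide_left_mono) auto
        have "1 / (real N)\<^sup>2 = 1 / real N * (1 / real N)" by (simp add: power2_eq_square)
        also have "\<dots> \<le> sigma_deg d ^ (2 * p) * (1 / (8 * G))"
          using p(4) GN G0 N sig by (intro mult_mono divide_left_mono) auto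
        finally show "1 / (real N)\<^sup>2 \<le> sigma_deg d ^ (2 * p) * (1 / (8 * G))" .
      qed
      also note walk
      finally show ?thesis .
    next
      case False
      have NM: "real N \<le> M" using False by (simp add: M_def)
      have "p \<le> P"
      proof -
        have "ln (real N) \<le> ln M" using NM N by simp
        then have "k * ln (real N) \<le> k * ln M" using k by (intro mult_left_mono) auto
        then have "real p \<le> k * ln M" using p(3) by linarith
        then show ?thesis unfolding P_def by linarith
      qed
      \<comment> \<open>The trace inequality with exponent 1; the main term is \<open>(N / d)\<^sup>2 * (d - 1) \<ge> 2\<close>.\<close>
      have "1 / (real N)\<^sup>2 \<le> s\<^sup>2"
      proof -
        have "ballot (2 * 1) 1 = 1" by (simp add: ballot_def)
        then have *: "(real N)\<^sup>2 * ((real d - 1) / (real d)\<^sup>2) \<le> 1 + (real N)\<^sup>2 * s\<^sup>2"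
          using second_singular_value_power_bound[of d N U 1, OF U' _ N] d by (simp add: s_def)
        have "1 * 2 \<le> (real N)\<^sup>2 / (real d)\<^sup>2 * (real d - 1)"
          using d dN' by (intro mult_mono) (auto simp: le_divide_eq power_mono)
        then have "1 \<le> (real N)\<^sup>2 * s\<^sup>2" using * by simp
        then show ?thesis using N by (simp add: divide_le_eq mult.commute)
      qed
      moreover have "(1 / M)\<^sup>2 \<le> 1 / (real N)\<^sup>2"
        using NM N by (simp add: power_divide frac_le power_mono)
      ultimately have "(1 / M)\<^sup>2 \<le> s\<^sup>2" by simp
      then have Ms: "1 / M \<le> s" using s0 by (rule power2_le_imp_le)
      have "sigma_deg d ^ (2 * p) * (c / ln (real N) powr (3 / 2)) \<le> 1 * (c / 1)"
        using p(5) sig c L by (intro mult_mono power_le_one divide_left_mono) auto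
      also have "\<dots> \<le> (1 / M) ^ (2 * P)" by (simp add: c_def)
      also have "\<dots> \<le> (1 / M) ^ (2 * p)"
        using M \<open>p \<le> P\<close> by (intro power_decreasing) auto
      also have "\<dots> \<le> s ^ (2 * p)" using Ms M by (intro power_mono) auto
      finally show ?thesis .
    qed
    then have "sigma_deg d * (c / ln (real N) powr (3 / 2)) powr (1 / real (2 * p)) \<le> s"
      using s0 c L p(1) by (intro mult_root_le) auto
    then show ?thesis using p(2) by (simp add: s_def)
  qed
  then show ?thesis using c by blast
qed

end
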